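(* Let $R>0$ and $t<1$. If $h\in W_h$ is a local minimizer of $$I(h)=\int_0^R r^2\Big(\frac12 |h'(r)|^2+\frac{3|h(r)|^2}{r^2}+g(h(r))\Big)\,dr$$ in $W_h$ and satisfies $0\leq h\leq h_+$, then $h$ is increasing on $(0,R)$. In addition, $h'(r)>0$ for every $r\in(0,R]$.
   Context: The real number $t$ is the dimensionless (reduced) temperature. The number $h_+$ is $$h_+=\frac{3+\sqrt{9-8t}}{4},$$ and $g:\mathbb{R}\to\mathbb{R}$ is the bulk energy density $$g(h)=\frac{t}{2}h^2-h^3+\frac12 h^4+C(t),$$ where the constant $C(t)$ is chosen so that $\min_{\mathbb{R}} g=0$ (the minimum being attained at $h_+$). The admissible space is $$W_h=\left\lbrace h\in L^2(0,R;dr)\ :\ h'\in L^2(0,R;r^2dr),\ h(R)=h_+\right\rbrace,$$ where $h'$ is the weak derivative of $h$ on $(0,R)$, functions are identified when equal almost everywhere (and with their continuous representative on $(0,R]$), and $h(R)$ is the value at $R$ of that representative. It is an affine space, endowed with the distance induced by the norm $\|\psi\|^2=\int_0^R \psi^2\,dr+\int_0^R r^2(\psi')^2\,dr$; "local minimizer" means that $I(h)\le I(k)$ for all $k\in W_h$ sufficiently close to $h$ in this distance. At $r=R$, $h'(R)$ denotes the one-sided (left) derivative. *)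

theory Defs
  imports "HOL-Analysis.Analysis"
begin

definition h_plus :: "real \<Rightarrow> real" where
  "h_plus t = (3 + sqrt (9 - 8 * t)) / 4"

definition bulk_const :: "real \<Rightarrow> real" where
  "bulk_const t = - (INF h::real. t / 2 * h^2 - h^3 + 1 / 2 * h^4)"

definition bulk :: "real \<Rightarrow> real \<Rightarrow> real" where
  "bulk t h = t / 2 * h^2 - h^3 + 1 / 2 * h^4 + bulk_const t"

lemma quartic_minimum:
  fixes t h :: real
  assumes "t \<le> 1"
  shows "t / 2 * (h_plus t)^2 - (h_plus t)^3 + 1 / 2 * (h_plus t)^4
         \<le> t / 2 * h^2 - h^3 + 1 / 2 * h^4"
proof -
  define a where "a = h_plus t"
  have s: "(sqrt (9 - 8 * t))^2 = 9 - 8 * t" using assms by simp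
  have "sqrt (9 - 8 * t) = 4 * a - 3" by (simp add: a_def h_plus_def field_simps)
  with s have "(4 * a - 3)^2 = 9 - 8 * t" by simp
  then have t: "t = 3 * a - 2 * a^2" by (simp add: power2_eq_square algebra_simps)
  have "sqrt (9 - 8 * t) \<ge> 1" using assms by simp
  then have a: "a \<ge> 1" by (simp add: a_def h_plus_def field_simps)
  have "(t / 2 * h^2 - h^3 + 1 / 2 * h^4) - (t / 2 * a^2 - a^3 + 1 / 2 * a^4)
        = 1 / 2 * (h - a)^2 * ((h + a - 1)^2 + (a - 1))"
    unfolding t by (simp add: field_simps power2_eq_square power3_eq_cube power4_eq_xxxx)
  also have "\<dots> \<ge> 0" using a by simp
  finally show ?thesis by (simp add: a_def)
qed

lemma bulk_h_plus: "t \<le> 1 \<Longrightarrow> bulk t (h_plus t) = 0"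
proof -
  assume t: "t \<le> 1"
  have "(INF h::real. t / 2 * h^2 - h^3 + 1 / 2 * h^4)
        = t / 2 * (h_plus t)^2 - (h_plus t)^3 + 1 / 2 * (h_plus t)^4"
    by (rule cInf_eq_minimum) (use quartic_minimum[OF t] in auto)
  then show ?thesis by (simp add: bulk_def bulk_const_def)
qed

lemma bulk_nonneg: "t \<le> 1 \<Longrightarrow> 0 \<le> bulk t h"
  using quartic_minimum[of t h] bulk_h_plus[of t] by (simp add: bulk_def)

definition locally_integrable :: "real set \<Rightarrow> (real \<Rightarrow> real) \<Rightarrow> bool" where
  "locally_integrable S f \<longleftrightarrow> (\<forall>K. compact K \<and> K \<subseteq> S \<longrightarrow> f absolutely_integrable_on K)"

definition test_function :: "real set \<Rightarrow> (real \<Rightarrow> real) \<Rightarrow> bool" where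
  "test_function S \<phi> \<longleftrightarrow>
     (\<forall>n x. (deriv ^^ n) \<phi> differentiable (at x)) \<and>
     compact (closure {x. \<phi> x \<noteq> 0}) \<and> closure {x. \<phi> x \<noteq> 0} \<subseteq> S"

definition has_weak_deriv :: "real set \<Rightarrow> (real \<Rightarrow> real) \<Rightarrow> (real \<Rightarrow> real) \<Rightarrow> bool" where
  "has_weak_deriv S f v \<longleftrightarrow>
     locally_integrable S f \<and> locally_integrable S v \<and>
     (\<forall>\<phi>. test_function S \<phi> \<longrightarrow>
        (LINT x:S|lebesgue. f x * deriv \<phi> x) = - (LINT x:S|lebesgue. v x * \<phi> x))"

text \<open>A weak derivative on an open set is unique up to a null set, so the choice below does not
  affect the integrals in which it occurs.\<close>

definition weak_deriv :: "real set \<Rightarrow> (real \<Rightarrow> real) \<Rightarrow> real \<Rightarrow> real" where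
  "weak_deriv S f = (SOME v. has_weak_deriv S f v)"

text \<open>An element of the admissible space is given by its representative that is continuous on
  \<open>(0,R]\<close>; the values of the function outside \<open>(0,R]\<close> are arbitrary and never used.\<close>

definition W_h :: "real \<Rightarrow> real \<Rightarrow> (real \<Rightarrow> real) set" where
  "W_h R t = {h. continuous_on {0<..R} h \<and>
     (\<lambda>r. (h r)^2) absolutely_integrable_on {0<..<R} \<and>
     (\<exists>v. has_weak_deriv {0<..<R} h v \<and>
          (\<lambda>r. r^2 * (v r)^2) absolutely_integrable_on {0<..<R}) \<and>
     h R = h_plus t}"

definition W_norm :: "real \<Rightarrow> (real \<Rightarrow> real) \<Rightarrow> real" where
  "W_norm R \<psi> = sqrt ((LINT r:{0<..<R}|lebesgue. (\<psi> r)^2) +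
                      (LINT r:{0<..<R}|lebesgue. r^2 * (weak_deriv {0<..<R} \<psi> r)^2))"

text \<open>On \<^term>\<open>W_h R t\<close> the integrand is integrable: \<open>r h(r)\<close> has the square-integrable weak
  derivative \<open>h + r h'\<close>, so it is bounded, and \<open>r\<^sup>2 h\<^sup>4 = (r h)\<^sup>2 h\<^sup>2\<close>.\<close>

definition energy :: "real \<Rightarrow> real \<Rightarrow> (real \<Rightarrow> real) \<Rightarrow> real" where
  "energy R t h = (LINT r:{0<..<R}|lebesgue.
     r^2 * (1 / 2 * \<bar>weak_deriv {0<..<R} h r\<bar>^2 + 3 * \<bar>h r\<bar>^2 / r^2 + bulk t (h r)))"

definition local_minimizer :: "real \<Rightarrow> real \<Rightarrow> (real \<Rightarrow> real) \<Rightarrow> bool" where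
  "local_minimizer R t h \<longleftrightarrow> h \<in> W_h R t \<and>
     (\<exists>\<delta>>0. \<forall>k\<in>W_h R t. W_norm R (\<lambda>r. k r - h r) < \<delta> \<longrightarrow> energy R t h \<le> energy R t k)"

end

theory Submission
  imports Defs
begin

text \<open>
  Write \<open>g\<close> for the bulk energy, \<open>g'(h) = t h - 3 h\<^sup>2 + 2 h\<^sup>3\<close>, and \<open>u = h'\<close>. A minimizer solves the
  Euler-Lagrange equation \<open>(r\<^sup>2 u)' = 6 h + r\<^sup>2 g'(h)\<close> and its second variation is nonnegative. The
  key observation is that \<open>u\<close> itself, cut off to an interval, is a destabilizing direction wherever it
  is negative. Differentiating the equation gives, on an interval \<open>[r1, r2]\<close> with \<open>u(r1) = u(r2) = 0\<close>,

    \<open>\<integral> r\<^sup>2 u'\<^sup>2 + 6 u\<^sup>2 + r\<^sup>2 g''(h) u\<^sup>2 = \<integral> (- 2 u\<^sup>2 + 12 h u / r)\<close>,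

  and if \<open>u \<le> 0\<close> is not identically zero there, then \<open>h \<ge> 0\<close> makes the right side negative. This
  contradicts stability (\<open>no_negative_well\<close>). A point with \<open>u < 0\<close> always lies in such an interval. To
  its right, \<open>u(R) \<ge> 0\<close> because \<open>h \<le> h(R)\<close>. To its left, \<open>u\<close> cannot stay negative down to \<open>0\<close>: near
  \<open>0\<close> the flux \<open>r\<^sup>2 u\<close> is nondecreasing, hence would be at most some \<open>- m < 0\<close>, and \<open>u \<le> - m / r\<^sup>2\<close> would
  make \<open>h\<close> unbounded (\<open>nonneg_point_near_0\<close>). So \<open>u \<ge> 0\<close>.

  Strict positivity comes from looking at a zero \<open>x\<close> of \<open>u \<ge> 0\<close>, where the nonnegative flux is minimal.
  In the interior the flux has derivative zero at \<open>x\<close>, so \<open>x\<^sup>2 g'(h) = - 6 h\<close>, and its second derivative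
  is \<open>2 x g'(h) = - 12 h / x < 0\<close>, which is impossible at a minimum; \<open>h(x) > 0\<close> holds by uniqueness for
  the equation. At \<open>x = R\<close> the flux would have derivative \<open>6 h\<^sub>+ > 0\<close> and be negative just before \<open>R\<close>.

  The remaining work is to reach the classical equation from the weak formulation. Smooth
  plateau functions show that a weak derivative integrates to increments of the continuous
  representative (\<open>integral_weak_deriv\<close>), and is therefore unique up to null sets. The energy along
  \<open>h + s \<psi>\<close> is a polynomial of degree at most 4 in \<open>s\<close>, whose first two coefficients are the two variations
  (\<open>minimizer_variations\<close>). Piecewise affine \<open>\<psi>\<close> in the first variation yield \<open>r\<^sup>2 h' = c + G\<close> almost
  everywhere with \<open>G' = 6 h + r\<^sup>2 g'(h)\<close> (\<open>minimizer_regular\<close>), so that \<open>h\<close> is twice differentiable on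
  \<open>(0,R]\<close>.
\<close>


section \<open>Smooth step functions\<close>

text \<open>Iterated derivatives are handled without computing them: it suffices to exhibit a class of
  functions that contains the given one and is closed under differentiation.\<close>

lemma smooth_if_in_deriv_closed_class:
  fixes \<phi> :: "real \<Rightarrow> real"
  assumes "\<phi> \<in> T" and T: "\<And>f. f \<in> T \<Longrightarrow> \<exists>g\<in>T. \<forall>x. (f has_real_derivative g x) (at x)"
  shows "(deriv ^^ n) \<phi> differentiable (at x)"
proof -
  have "(deriv ^^ n) \<phi> \<in> T"
  proof (induction n)
    case (Suc n)
    then obtain g where g: "g \<in> T" "\<And>x. ((deriv ^^ n) \<phi> has_real_derivative g x) (at x)"
      using T by blast
    have "deriv ((deriv ^^ n) \<phi>) = g" using g(2) by (intro ext DERIV_imp_deriv)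
    with g(1) show ?case by simp
  qed (use assms(1) in simp)
  then show ?thesis using T real_differentiable_def by blast
qed

lemma has_real_derivative_0_if_quadratic_bound:
  fixes f :: "real \<Rightarrow> real"
  assumes "\<And>y. \<bar>f y\<bar> \<le> C * (y - x)^2"
  shows "(f has_real_derivative 0) (at x)"
proof -
  have fx: "f x = 0" using assms[of x] by simp
  have "((\<lambda>y. (f y - f x) / (y - x)) \<longlongrightarrow> 0) (at x)"
  proof (rule Lim_null_comparison)
    show "\<forall>\<^sub>F y in at x. norm ((f y - f x) / (y - x)) \<le> \<bar>C\<bar> * \<bar>y - x\<bar>"
    proof (rule always_eventually, rule allI)
      fix y
      show "norm ((f y - f x) / (y - x)) \<le> \<bar>C\<bar> * \<bar>y - x\<bar>"
      proof (cases "y = x")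
        case False
        have "\<bar>f y\<bar> \<le> \<bar>C\<bar> * \<bar>y - x\<bar> * \<bar>y - x\<bar>"
          using assms[of y] mult_right_mono[OF abs_ge_self[of C], of "(y - x)^2"]
          by (simp add: power2_eq_square)
        then show ?thesis using False by (simp add: fx divide_simps)
      qed simp
    qed
    have "((\<lambda>y. \<bar>C\<bar> * \<bar>y - x\<bar>) \<longlongrightarrow> \<bar>C\<bar> * \<bar>x - x\<bar>) (at x)" by (intro tendsto_intros)
    then show "((\<lambda>y. \<bar>C\<bar> * \<bar>y - x\<bar>) \<longlongrightarrow> 0) (at x)" by simp
  qed
  then show ?thesis by (simp add: has_field_derivative_iff)
qed

text \<open>With \<open>m = x (1 - x)\<close> these are the functions \<open>p / m\<^sup>k * exp (- 1 / m)\<close> on \<open>(0,1)\<close>. Polynomial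
  numerators and arbitrary powers of \<open>m\<close> are admitted because the class is then closed under
  differentiation.\<close>

definition bump :: "real poly \<Rightarrow> nat \<Rightarrow> real \<Rightarrow> real" where
  "bump p k x = (if 0 < x \<and> x < 1
     then poly p x / (x * (1 - x))^k * exp (- 1 / (x * (1 - x))) else 0)"

definition bump_deriv_poly :: "real poly \<Rightarrow> nat \<Rightarrow> real poly" where
  "bump_deriv_poly p k = pderiv p * [:0, 1, - 1:]^2
     - smult (real k) (p * [:1, - 2:] * [:0, 1, - 1:]) + p * [:1, - 2:]"

lemma exp_inverse_le_power:
  fixes m :: real
  assumes "0 < m"
  shows "exp (- 1 / m) / m^k \<le> fact (k + 2) * m^2"
proof -
  define n where "n = k + 2"
  have "(\<Sum>i\<in>{n}. (1 / m)^i /\<^sub>R fact i) \<le> (\<Sum>i. (1 / m)^i /\<^sub>R fact i)"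
    by (intro sum_le_suminf summable_exp_generic) (use assms in auto)
  then have "(1 / m)^n / fact n \<le> exp (1 / m)" by (simp add: exp_def divide_inverse ac_simps)
  then have "1 \<le> fact n * m^n * exp (1 / m)"
    using assms by (simp add: field_simps)
  then have "exp (- 1 / m) \<le> fact n * m^n"
    by (simp add: exp_minus divide_simps mult_ac)
  then have "exp (- 1 / m) / m^k \<le> fact n * m^n / m^k"
    using assms by (intro divide_right_mono) auto
  also have "\<dots> = fact n * m^2" using assms by (simp add: n_def power_add power2_eq_square del: fact_Suc)
  finally show ?thesis by (simp only: n_def)
qed

text \<open>Since \<open>exp (- 1 / m)\<close> decays faster than any power of \<open>m\<close>, each function of the class vanishes to
  second order at both ends of \<open>(0,1)\<close>; this gives differentiability at \<open>0\<close> and \<open>1\<close>.\<close>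

lemma bump_quadratic_bound:
  "\<exists>C. \<forall>x. \<bar>bump p k x\<bar> \<le> C * x^2 \<and> \<bar>bump p k x\<bar> \<le> C * (x - 1)^2"
proof -
  have "compact (poly p ` {0..1})" by (intro compact_continuous_image continuous_intros) auto
  then obtain B where B: "\<And>x. 0 \<le> x \<Longrightarrow> x \<le> 1 \<Longrightarrow> \<bar>poly p x\<bar> \<le> B"
    using compact_imp_bounded bounded_iff by (metis (no_types, lifting) atLeastAtMost_iff image_eqI real_norm_def)
  have B0: "0 \<le> B" using B[of 0] by simp
  define C where "C = B * fact (k + 2)"
  have *: "\<bar>bump p k x\<bar> \<le> C * (x * (1 - x))^2" for x
  proof (cases "0 < x \<and> x < 1")
    case True
    then have m: "0 < x * (1 - x)" by simp
    have "\<bar>bump p k x\<bar> = \<bar>poly p x\<bar> * (exp (- 1 / (x * (1 - x))) / (x * (1 - x))^k)"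
      using True m by (simp add: bump_def abs_mult)
    also have "\<dots> \<le> B * (fact (k + 2) * (x * (1 - x))^2)"
      using True m B0 B[of x] exp_inverse_le_power[OF m, of k] by (intro mult_mono) auto
    finally show ?thesis by (simp add: C_def mult.assoc)
  qed (use B0 in \<open>auto simp: bump_def C_def\<close>)
  have C0: "0 \<le> C" using B0 by (simp add: C_def)
  have "\<bar>bump p k x\<bar> \<le> C * x^2 \<and> \<bar>bump p k x\<bar> \<le> C * (x - 1)^2" for x
  proof (cases "0 < x \<and> x < 1")
    case True
    have "x * (1 - x) \<le> x" "x * (1 - x) \<le> 1 - x"
      using True by (auto intro: mult_left_le mult_left_le_one_le)
    then have "(x * (1 - x))^2 \<le> x^2" "(x * (1 - x))^2 \<le> (1 - x)^2"
      using True by (auto intro!: power_mono)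
    then have "C * (x * (1 - x))^2 \<le> C * x^2" "C * (x * (1 - x))^2 \<le> C * (x - 1)^2"
      using C0 by (auto intro!: mult_left_mono simp: power2_commute)
    then show ?thesis using *[of x] by linarith
  qed (use C0 in \<open>auto simp: bump_def\<close>)
  then show ?thesis by blast
qed

lemma bump_has_derivative:
  "(bump p k has_real_derivative bump (bump_deriv_poly p k) (k + 2) x) (at x)"
proof -
  consider "0 < x" "x < 1" | "x < 0" | "1 < x" | "x = 0" | "x = 1" by linarith
  then show ?thesis
  proof cases
    case 1
    define m where "m = x * (1 - x)"
    have m: "m \<noteq> 0" using 1 by (simp add: m_def)
    have dm: "((\<lambda>x. x * (1 - x)) has_real_derivative 1 - 2 * x) (at x)"
      by (auto intro!: derivative_eq_intros)
    have d1: "((\<lambda>x. poly p x / (x * (1 - x))^k) has_real_derivative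
        (poly (pderiv p) x * m^k - poly p x * (real k * m^(k - 1) * (1 - 2 * x))) / (m^k * m^k)) (at x)"
      using m by (auto intro!: derivative_eq_intros dm simp: m_def)
    have d2: "((\<lambda>x. exp (- 1 / (x * (1 - x)))) has_real_derivative
        exp (- 1 / m) * ((1 - 2 * x) / m^2)) (at x)"
      using m by (auto intro!: derivative_eq_intros dm simp: m_def power2_eq_square divide_simps)
         (simp add: algebra_simps)?
    define N where "N = poly (pderiv p) x * m^k - poly p x * (real k * m^(k - 1) * (1 - 2 * x))"
    define Q where "Q = poly (pderiv p) x * m - real k * (poly p x * (1 - 2 * x))"
    have k: "real k * m^(k - 1) * m = real k * m^k" by (cases k) auto
    have "N * m = poly (pderiv p) x * m^k * m - poly p x * (1 - 2 * x) * (real k * m^(k - 1) * m)"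
      by (simp add: N_def algebra_simps)
    also have "\<dots> = m^k * Q" unfolding k by (simp add: Q_def algebra_simps)
    finally have NQ: "N * m = m^k * Q" .
    have "N / (m^k * m^k) = N * m / (m^k * m^k * m)" using m by simp
    also have "\<dots> = Q * m / m^(k + 2)"
      using m unfolding NQ by (simp add: power_add power2_eq_square)
    finally have quot: "N / (m^k * m^k) = Q * m / m^(k + 2)" .
    have poly: "poly (bump_deriv_poly p k) x = Q * m + poly p x * (1 - 2 * x)"
    proof -
      have "poly [:0, 1, - 1:] x = m" "poly [:1, - 2:] x = 1 - 2 * x"
        by (simp_all add: m_def algebra_simps)
      then have "poly (bump_deriv_poly p k) x = poly (pderiv p) x * m^2
          - real k * (poly p x * (1 - 2 * x) * m) + poly p x * (1 - 2 * x)"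
        by (simp only: bump_deriv_poly_def poly_add poly_diff poly_mult poly_power poly_smult)
      then show ?thesis by (simp add: Q_def power2_eq_square left_diff_distrib)
    qed
    have "((\<lambda>x. poly p x / (x * (1 - x))^k * exp (- 1 / (x * (1 - x)))) has_real_derivative
       bump (bump_deriv_poly p k) (k + 2) x) (at x)"
    proof (rule DERIV_cong[OF DERIV_mult[OF d1 d2]])
      have "exp (- 1 / m) * ((1 - 2 * x) / m\<^sup>2) * (poly p x / m^k)
        = poly p x * (1 - 2 * x) / m^(k + 2) * exp (- 1 / m)"
        by (simp add: power_add power2_eq_square mult_ac)
      moreover have "bump (bump_deriv_poly p k) (k + 2) x
        = (Q * m + poly p x * (1 - 2 * x)) / m^(k + 2) * exp (- 1 / m)"
        using 1 by (simp only: bump_def poly m_def) simp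
      ultimately show "(poly (pderiv p) x * m ^ k - poly p x * (real k * m ^ (k - 1) * (1 - 2 * x))) /
        (m ^ k * m ^ k) * exp (- 1 / (x * (1 - x))) +
        exp (- 1 / m) * ((1 - 2 * x) / m\<^sup>2) * (poly p x / (x * (1 - x)) ^ k) =
        bump (bump_deriv_poly p k) (k + 2) x"
        unfolding N_def[symmetric] m_def[symmetric] quot
        by (simp only: add_divide_distrib distrib_right)
    qed
    then show ?thesis
      by (rule has_field_derivative_transform_within_open[of _ _ _ "{0<..<1}"])
         (use 1 in \<open>auto simp: bump_def\<close>)
  next
    case 2
    have "((\<lambda>_. 0) has_real_derivative 0) (at x)" by simp
    then have "(bump p k has_real_derivative 0) (at x)"
      by (rule has_field_derivative_transform_within_open[of _ _ _ "{..<0}"])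
         (use 2 in \<open>auto simp: bump_def\<close>)
    moreover have "bump (bump_deriv_poly p k) (k + 2) x = 0" using 2 by (simp add: bump_def)
    ultimately show ?thesis by simp
  next
    case 3
    have "((\<lambda>_. 0) has_real_derivative 0) (at x)" by simp
    then have "(bump p k has_real_derivative 0) (at x)"
      by (rule has_field_derivative_transform_within_open[of _ _ _ "{1<..}"])
         (use 3 in \<open>auto simp: bump_def\<close>)
    moreover have "bump (bump_deriv_poly p k) (k + 2) x = 0" using 3 by (simp add: bump_def)
    ultimately show ?thesis by simp
  next
    case 4
    obtain C where "\<And>y. \<bar>bump p k y\<bar> \<le> C * (y - x)^2"
      using bump_quadratic_bound[of p k] 4 by auto
    then have "(bump p k has_real_derivative 0) (at x)"
      by (rule has_real_derivative_0_if_quadratic_bound)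
    moreover have "bump (bump_deriv_poly p k) (k + 2) x = 0" using 4 by (simp add: bump_def)
    ultimately show ?thesis by simp
  next
    case 5
    obtain C where "\<And>y. \<bar>bump p k y\<bar> \<le> C * (y - x)^2"
      using bump_quadratic_bound[of p k] 5 by auto
    then have "(bump p k has_real_derivative 0) (at x)"
      by (rule has_real_derivative_0_if_quadratic_bound)
    moreover have "bump (bump_deriv_poly p k) (k + 2) x = 0" using 5 by (simp add: bump_def)
    ultimately show ?thesis by simp
  qed
qed

text \<open>The step is the normalized primitive of \<open>exp (- 1 / (x (1 - x)))\<close>.\<close>

lemma smooth_step_exists:
  obtains H \<eta> :: "real \<Rightarrow> real"
  where "\<And>x. (H has_real_derivative \<eta> x) (at x)" and "continuous_on UNIV \<eta>"
    and "\<And>x. 0 \<le> \<eta> x" and "\<And>x. x \<notin> {0<..<1} \<Longrightarrow> \<eta> x = 0"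
    and "\<And>x. x \<le> 0 \<Longrightarrow> H x = 0" and "\<And>x. x \<ge> 1 \<Longrightarrow> H x = 1"
    and "\<And>n x. (deriv ^^ n) H differentiable (at x)"
proof -
  define b where "b = bump 1 0"
  have bd: "\<And>x. (b has_real_derivative bump (bump_deriv_poly 1 0) 2 x) (at x)"
    using bump_has_derivative[of 1 0] by (simp add: b_def numeral_2_eq_2)
  have bc: "continuous_on S b" for S
    by (rule DERIV_continuous_on[OF has_field_derivative_at_within[OF bd]])
  have b0: "0 \<le> b x" for x by (simp add: b_def bump_def)
  have bz: "b x = 0" if "x \<notin> {0<..<1}" for x using that by (auto simp: b_def bump_def)
  \<comment> \<open>Starting at -1 rather than 0 keeps the point 0, where the bump begins, inside the interval.\<close>
  define K where "K = (\<lambda>x. integral {-1..x} b)"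
  have bi: "b integrable_on {x..y}" for x y by (intro integrable_continuous_interval bc)
  have K0: "K x = 0" if "x \<le> 0" for x
    unfolding K_def by (subst integral_cong[of _ b "\<lambda>_. 0"]) (use bz that in auto)
  have Kd: "(K has_real_derivative b x) (at x)" for x
  proof (cases "x < 0")
    case True
    have "((\<lambda>_. 0) has_real_derivative 0) (at x)" by simp
    then have "(K has_real_derivative 0) (at x)"
      by (rule has_field_derivative_transform_within_open[of _ _ _ "{..<0}"])
         (use True K0 in auto)
    then show ?thesis using True bz[of x] by simp
  next
    case False
    have "(K has_vector_derivative b x) (at x within {-1..x+1})"
      unfolding K_def by (rule integral_has_vector_derivative) (use False bc in auto)
    then have "(K has_real_derivative b x) (at x within {-1..x+1})"
      by (simp add: has_real_derivative_iff_has_vector_derivative)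
    moreover have "at x within {-1..x+1} = at x"
      by (rule at_within_interior) (use False in \<open>auto simp: interior_atLeastAtMost_real\<close>)
    ultimately show ?thesis by simp
  qed
  have K1: "K x = K 1" if "x \<ge> 1" for x
  proof -
    have "integral {-1..1} b + integral {1..x} b = integral {-1..x} b"
      by (rule Henstock_Kurzweil_Integration.integral_combine) (use that bi in auto)
    moreover have "integral {1..x} b = 0" by (subst integral_cong[of _ b "\<lambda>_. 0"]) (use bz in auto)
    ultimately show ?thesis by (simp add: K_def)
  qed
  have "K 0 < K 1"
  proof -
    have "K 0 < K (1/2)"
    proof (rule DERIV_pos_imp_increasing_open[of 0 "1/2" K])
      show "\<exists>y. (K has_real_derivative y) (at x) \<and> 0 < y" if "0 < x" "x < 1/2" for x
        using Kd[of x] that by (intro exI[of _ "b x"]) (simp add: b_def bump_def)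
      show "continuous_on {0..1/2} K"
        by (rule DERIV_continuous_on[OF has_field_derivative_at_within[OF Kd]])
    qed simp
    also have "K (1/2) \<le> K 1"
      by (rule DERIV_nonneg_imp_nondecreasing[of "1/2" 1 K]) (use Kd b0 in auto)
    finally show ?thesis .
  qed
  then have c: "K 1 > 0" using K0[of 0] by simp
  define H where "H = (\<lambda>x. K x / K 1)"
  define \<eta> where "\<eta> = (\<lambda>x. b x / K 1)"
  have Hd: "(H has_real_derivative \<eta> x) (at x)" for x
    unfolding H_def \<eta>_def by (intro DERIV_cdivide Kd)
  define T where "T = {H} \<union> {\<lambda>x. bump p k x / K 1 | p k. True}"
  have sm: "(deriv ^^ n) H differentiable (at x)" for n x
  proof (rule smooth_if_in_deriv_closed_class[of _ T])
    show "H \<in> T" by (simp add: T_def)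
    fix f assume "f \<in> T"
    then consider "f = H" | p k where "f = (\<lambda>x. bump p k x / K 1)" by (auto simp: T_def)
    then show "\<exists>g\<in>T. \<forall>x. (f has_real_derivative g x) (at x)"
    proof cases
      case 1
      then show ?thesis using Hd by (intro bexI[of _ \<eta>]) (auto simp: T_def \<eta>_def b_def)
    next
      case 2
      show ?thesis
      proof (intro bexI allI)
        show "(\<lambda>x. bump (bump_deriv_poly p k) (k + 2) x / K 1) \<in> T" unfolding T_def by blast
        show "(f has_real_derivative bump (bump_deriv_poly p k) (k + 2) x / K 1) (at x)" for x
          unfolding 2 by (rule DERIV_cdivide[OF bump_has_derivative])
      qed
    qed
  qed
  show ?thesis
  proof (rule that[of H \<eta>])
    show "continuous_on UNIV \<eta>" unfolding \<eta>_def using c by (intro continuous_intros bc) auto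
    show "H x = 1" if "x \<ge> 1" for x using K1[OF that] c by (simp add: H_def)
    show "0 \<le> \<eta> x" for x using b0 c by (simp add: \<eta>_def)
    show "\<eta> x = 0" if "x \<notin> {0<..<1}" for x using bz[OF that] by (simp add: \<eta>_def)
    show "H x = 0" if "x \<le> 0" for x using K0[OF that] by (simp add: H_def)
  qed (fact Hd sm)+
qed


section \<open>Functions with vanishing integrals\<close>

lemma sigma_finite_lebesgue_real: "sigma_finite_measure (lebesgue :: real measure)"
proof
  have "x \<in> (\<Union>n. {- real n..real n})" for x
  proof -
    obtain n where "\<bar>x\<bar> \<le> real n" using real_arch_simple by blast
    then have "x \<in> {- real n..real n}" by auto
    then show ?thesis by blast
  qed
  then have "\<Union>(range (\<lambda>n. {- real n..real n})) = UNIV" by blast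
  then show "\<exists>A. countable A \<and> A \<subseteq> sets lebesgue \<and> \<Union>A = space (lebesgue :: real measure)
      \<and> (\<forall>a\<in>A. emeasure lebesgue a \<noteq> \<infinity>)"
    by (intro exI[of _ "range (\<lambda>n. {- real n..real n})"]) auto
qed

text \<open>The sets over which the integral vanishes contain all intervals and are closed under complement
  and disjoint countable union, so they contain the Borel sets, and then all Lebesgue sets because
  these differ from Borel sets by null sets.\<close>

lemma eq_0_outside_negligible_if_integrals_0:
  fixes f :: "real \<Rightarrow> real"
  assumes f: "f absolutely_integrable_on {a..b}"
    and 0: "\<And>x y. a \<le> x \<Longrightarrow> x \<le> y \<Longrightarrow> y \<le> b \<Longrightarrow> integral {x..y} f = 0"
  shows "\<exists>N. negligible N \<and> (\<forall>x\<in>{a..b} - N. f x = 0)"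
proof -
  define g where "g = (\<lambda>x. indicator {a..b} x *\<^sub>R f x)"
  have g: "integrable lebesgue g" using f by (simp add: g_def set_integrable_def)
  have gs: "set_integrable lebesgue A g" if "A \<in> sets lebesgue" for A
    using g that unfolding set_integrable_def by (intro integrable_mult_indicator)
  have Icc: "(LINT x:{c..d}|lebesgue. g x) = 0" for c d
  proof -
    have "(LINT x:{c..d}|lebesgue. g x) = (LINT x:{max a c..min b d}|lebesgue. f x)"
      unfolding set_lebesgue_integral_def g_def
      by (intro Bochner_Integration.integral_cong) (auto split: split_indicator)
    also have "\<dots> = integral {max a c..min b d} f"
      by (intro set_lebesgue_integral_eq_integral set_integrable_subset[OF f]) auto
    also have "\<dots> = 0" using 0[of "max a c" "min b d"]
      by (cases "max a c \<le> min b d") auto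
    finally show ?thesis .
  qed
  have total: "integral\<^sup>L lebesgue g = 0"
  proof -
    have "(LINT x:{a..b}|lebesgue. g x) = integral\<^sup>L lebesgue g"
      unfolding set_lebesgue_integral_def g_def
      by (intro Bochner_Integration.integral_cong) (auto split: split_indicator)
    then show ?thesis using Icc[of a b] by simp
  qed
  have borel: "(LINT x:A|lebesgue. g x) = 0" if "A \<in> sets borel" for A
    using that
  proof (induction rule: borel_set_induct)
    case (compl B)
    have "(LINT x:B|lebesgue. g x) + (LINT x:- B|lebesgue. g x) = (LINT x:B \<union> - B|lebesgue. g x)"
      by (rule set_integral_Un[symmetric]) (use gs compl.hyps in auto)
    also have "\<dots> = 0" using total by (simp add: set_lebesgue_integral_def)
    finally show ?case using compl by simp
  next
    case (union B)
    have "(LINT x:(\<Union>i. B i)|lebesgue. g x) = (\<Sum>i. LINT x:B i|lebesgue. g x)"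
      by (rule lebesgue_integral_countable_add)
         (use gs union in \<open>auto simp: disjoint_family_on_def\<close>)
    then show ?case using union by simp
  qed (use Icc in \<open>auto simp: set_lebesgue_integral_def\<close>)
  have "AE x in lebesgue. g x = 0"
  proof (rule sigma_finite_measure.density_zero[OF sigma_finite_lebesgue_real g])
    fix A :: "real set" assume "A \<in> sets lebesgue"
    then obtain C T where CT: "fsigma C" "T \<in> null_sets lebesgue" "C \<union> T = A" "disjnt C T"
      by (rule lebesgue_set_almost_fsigma)
    have C: "C \<in> sets borel" using CT(1) by (cases rule: fsigma.cases) auto
    have T: "T \<in> sets lebesgue" using CT(2) by blast
    have "(LINT x:A|lebesgue. g x) = (LINT x:C|lebesgue. g x) + (LINT x:T|lebesgue. g x)"
      unfolding CT(3)[symmetric]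
      by (rule set_integral_Un) (use CT(4) C T gs in \<open>auto simp: disjnt_def\<close>)
    also have "(LINT x:T|lebesgue. g x) = 0"
      unfolding set_lebesgue_integral_def using AE_not_in[OF CT(2)]
      by (intro integral_eq_zero_AE) (auto elim!: eventually_mono split: split_indicator)
    finally show "(LINT x:A|lebesgue. g x) = 0" using borel[OF C] by simp
  qed
  then obtain N where "N \<in> null_sets lebesgue" "\<And>x. x \<notin> N \<Longrightarrow> g x = 0"
    by (rule AE_E3) auto
  then show ?thesis
    by (intro exI[of _ N]) (fastforce simp: negligible_iff_null_sets g_def)
qed

lemma locally_integrableD:
  assumes "locally_integrable {l<..<u} f" "l < a" "b < u"
  shows "f absolutely_integrable_on {a..b}"
proof -
  have "{a..b} \<subseteq> {l<..<u}" using assms by auto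
  then show ?thesis using assms(1) by (simp add: locally_integrable_def)
qed

lemma eq_0_outside_negligible_if_integrals_0_open:
  fixes f :: "real \<Rightarrow> real"
  assumes f: "locally_integrable {l<..<u} f"
    and 0: "\<And>x y. l < x \<Longrightarrow> x \<le> y \<Longrightarrow> y < u \<Longrightarrow> integral {x..y} f = 0"
  shows "\<exists>N. negligible N \<and> (\<forall>x\<in>{l<..<u} - N. f x = 0)"
proof -
  define e where "e = (\<lambda>n::nat. inverse (real (Suc n)))"
  have e: "0 < e n" for n by (simp add: e_def)
  have "\<exists>N. negligible N \<and> (\<forall>x\<in>{l + e n..u - e n} - N. f x = 0)" for n
    using e[of n] by (intro eq_0_outside_negligible_if_integrals_0 locally_integrableD[OF f] 0) auto
  then obtain N where N: "\<And>n. negligible (N n)" "\<And>n x. x \<in> {l + e n..u - e n} - N n \<Longrightarrow> f x = 0"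
    by metis
  have "f x = 0" if x: "x \<in> {l<..<u}" "x \<notin> (\<Union>n. N n)" for x
  proof -
    obtain n where "inverse (real (Suc n)) < min (x - l) (u - x)"
      using reals_Archimedean[of "min (x - l) (u - x)"] x by auto
    then show ?thesis using N(2)[of x n] x by (auto simp: e_def)
  qed
  moreover have "negligible (\<Union>n. N n)" using N(1) by (intro negligible_countable_Union) auto
  ultimately show ?thesis by (intro exI[of _ "\<Union>n. N n"]) auto
qed

text \<open>If one of the functions is not integrable, then neither is the other, and both integrals are \<open>0\<close>
  by convention.\<close>

lemma set_lebesgue_integral_spike:
  fixes f g :: "real \<Rightarrow> real"
  assumes "negligible N" "\<And>x. x \<in> S - N \<Longrightarrow> f x = g x"
  shows "(LINT x:S|lebesgue. f x) = (LINT x:S|lebesgue. g x)"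
proof (cases "f absolutely_integrable_on S")
  case True
  then have g: "g absolutely_integrable_on S"
    by (rule absolutely_integrable_spike) (use assms in auto)
  have "integral S f = integral S g" by (rule integral_spike) (use assms in auto)
  then show ?thesis using True g by (simp add: set_lebesgue_integral_eq_integral)
next
  case False
  then have "\<not> g absolutely_integrable_on S"
    using absolutely_integrable_spike[where f=g and T=S and S=N and g=f] assms by auto
  with False show ?thesis
    by (simp add: set_integrable_def set_lebesgue_integral_def not_integrable_integral_eq)
qed

lemma set_lebesgue_integral_support:
  fixes f :: "real \<Rightarrow> real"
  assumes "K \<subseteq> S" "\<And>x. x \<in> S - K \<Longrightarrow> f x = 0"
  shows "(LINT x:S|lebesgue. f x) = (LINT x:K|lebesgue. f x)"
    and "f absolutely_integrable_on S \<longleftrightarrow> f absolutely_integrable_on K"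
proof -
  have *: "(\<lambda>x. indicator S x *\<^sub>R f x) = (\<lambda>x. indicator K x *\<^sub>R f x)"
    using assms by (intro ext) (auto split: split_indicator)
  show "(LINT x:S|lebesgue. f x) = (LINT x:K|lebesgue. f x)"
    unfolding set_lebesgue_integral_def * ..
  show "f absolutely_integrable_on S \<longleftrightarrow> f absolutely_integrable_on K"
    unfolding set_integrable_def * ..
qed

lemma absolutely_integrable_mult_continuous:
  fixes f g :: "real \<Rightarrow> real"
  assumes "f absolutely_integrable_on K" "compact K" "continuous_on K g"
  shows "(\<lambda>x. f x * g x) absolutely_integrable_on K"
proof -
  have K: "K \<in> sets lebesgue" using compact_imp_closed[OF assms(2)] by simp
  have "(\<lambda>x. g x * f x) absolutely_integrable_on K"
    by (intro absolutely_integrable_bounded_measurable_product_real assms K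
          compact_imp_bounded compact_continuous_image continuous_imp_measurable_on_sets_lebesgue)
  then show ?thesis by (simp add: mult.commute)
qed

section \<open>Weak derivatives of continuous functions\<close>

text \<open>The functions \<open>m \<eta> (m (x - p))\<close> are an approximate identity that concentrates at \<open>p\<close> from the
  right, so only values of \<open>f\<close> to the right of \<open>p\<close> enter, and \<open>p\<close> may be the left endpoint.\<close>

lemma scaled_bump_integral_tendsto:
  fixes f H \<eta> :: "real \<Rightarrow> real"
  assumes f: "continuous_on {a..c} f" and p: "a \<le> p" "p < c"
    and H: "\<And>x. (H has_real_derivative \<eta> x) (at x)" "continuous_on UNIV \<eta>"
      "\<And>x. 0 \<le> \<eta> x" "\<And>x. x \<notin> {0<..<1} \<Longrightarrow> \<eta> x = 0"
      "\<And>x. x \<le> 0 \<Longrightarrow> H x = 0" "\<And>x. x \<ge> 1 \<Longrightarrow> H x = 1"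
    and m: "filterlim m at_top sequentially"
  shows "(\<lambda>n. integral {a..c} (\<lambda>x. f x * (m n * \<eta> (m n * (x - p))))) \<longlonglongrightarrow> f p"
proof (rule LIMSEQ_I)
  fix e :: real assume e: "e > 0"
  obtain d where d: "d > 0" "\<And>x. x \<in> {a..c} \<Longrightarrow> dist x p < d \<Longrightarrow> dist (f x) (f p) < e/2"
    using f p e unfolding continuous_on_iff by (metis atLeastAtMost_iff half_gt_zero less_imp_le)
  define M where "M = max 1 (1 / min d (c - p))"
  have "\<forall>\<^sub>F n in sequentially. M \<le> m n" using m by (simp add: filterlim_at_top)
  then obtain N where N: "\<And>n. n \<ge> N \<Longrightarrow> M \<le> m n" by (auto simp: eventually_sequentially)
  have "norm (integral {a..c} (\<lambda>x. f x * (m n * \<eta> (m n * (x - p)))) - f p) < e" if "n \<ge> N" for n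
  proof -
    define k where "k = m n"
    have k: "k \<ge> 1" "1 / min d (c - p) \<le> k" using N[OF that] by (auto simp: k_def M_def)
    have k1: "1 / k \<le> d" "1 / k \<le> c - p"
    proof -
      have "1 / k \<le> min d (c - p)" using k d p by (simp add: field_simps min_def split: if_splits)
      then show "1 / k \<le> d" "1 / k \<le> c - p" by auto
    qed
    have ec: "continuous_on {a..c} (\<lambda>x. k * \<eta> (k * (x - p)))"
      by (intro continuous_intros continuous_on_compose2[OF H(2)]) auto
    have "((\<lambda>x. k * \<eta> (k * (x - p))) has_integral H (k * (c - p)) - H (k * (a - p))) {a..c}"
    proof (rule fundamental_theorem_of_calculus)
      fix x
      have "((\<lambda>x. H (k * (x - p))) has_real_derivative k * \<eta> (k * (x - p))) (at x)"
        by (rule DERIV_chain2[OF H(1), THEN DERIV_cong]) (auto intro!: derivative_eq_intros)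
      then show "((\<lambda>x. H (k * (x - p))) has_vector_derivative k * \<eta> (k * (x - p))) (at x within {a..c})"
        unfolding has_real_derivative_iff_has_vector_derivative[symmetric]
        by (rule has_field_derivative_at_within)
    qed (use p in simp)
    moreover have "H (k * (c - p)) = 1" using k1 k by (intro H) (simp add: field_simps)
    moreover have "H (k * (a - p)) = 0" using p k by (intro H) (simp add: mult_nonneg_nonpos)
    ultimately have one: "((\<lambda>x. k * \<eta> (k * (x - p))) has_integral 1) {a..c}" by simp
    have i1: "(\<lambda>x. f x * (k * \<eta> (k * (x - p)))) integrable_on {a..c}"
      by (intro integrable_continuous_interval continuous_on_mult f ec)
    have "integral {a..c} (\<lambda>x. f x * (k * \<eta> (k * (x - p)))) - f p
      = integral {a..c} (\<lambda>x. f x * (k * \<eta> (k * (x - p))) - f p * (k * \<eta> (k * (x - p))))"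
      using has_integral_mult_right[OF one, of "f p"] i1
      by (subst Henstock_Kurzweil_Integration.integral_diff) (auto simp: has_integral_iff)
    also have "norm \<dots> \<le> integral {a..c} (\<lambda>x. e/2 * (k * \<eta> (k * (x - p))))"
    proof (rule integral_norm_bound_integral)
      show "(\<lambda>x. e/2 * (k * \<eta> (k * (x - p)))) integrable_on {a..c}"
        using has_integral_mult_right[OF one] by (rule has_integral_integrable)
      show "(\<lambda>x. f x * (k * \<eta> (k * (x - p))) - f p * (k * \<eta> (k * (x - p)))) integrable_on {a..c}"
        using has_integral_integrable[OF has_integral_mult_right[OF one, of "f p"]] i1
        by (rule Henstock_Kurzweil_Integration.integrable_diff[rotated])
      fix x assume x: "x \<in> {a..c}"
      have "\<bar>f x - f p\<bar> * (k * \<eta> (k * (x - p))) \<le> e/2 * (k * \<eta> (k * (x - p)))"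
      proof (cases "k * (x - p) \<in> {0<..<1}")
        case True
        then have "dist x p < 1 / k" using k by (auto simp: dist_real_def field_simps zero_less_mult_iff)
        then have "\<bar>f x - f p\<bar> \<le> e/2" using d(2)[OF x] k1 by (simp add: dist_real_def)
        then show ?thesis using k H(3) by (intro mult_right_mono) auto
      qed (simp add: H(4))
      moreover have "norm (f x * (k * \<eta> (k * (x - p))) - f p * (k * \<eta> (k * (x - p))))
        = \<bar>f x - f p\<bar> * (k * \<eta> (k * (x - p)))"
        using k H(3) by (simp add: left_diff_distrib[symmetric] abs_mult)
      ultimately show "norm (f x * (k * \<eta> (k * (x - p))) - f p * (k * \<eta> (k * (x - p))))
        \<le> e/2 * (k * \<eta> (k * (x - p)))" by simp
    qed
    also have "\<dots> = e/2" using has_integral_mult_right[OF one, of "e/2"] by (simp add: has_integral_iff)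
    finally show ?thesis using e by (simp add: k_def)
  qed
  then show "\<exists>N. \<forall>n\<ge>N. norm (integral {a..c} (\<lambda>x. f x * (m n * \<eta> (m n * (x - p)))) - f p) < e"
    by blast
qed

text \<open>For \<open>a < b\<close> and \<open>H\<close> a smooth step this is a smooth plateau over \<open>[a,b]\<close>. Its iterated derivatives
  stay in the class of differences \<open>c H\<^sup>(\<^sup>i\<^sup>) (k (x - a)) - c H\<^sup>(\<^sup>i\<^sup>) (k (x - b))\<close>.\<close>

lemma smooth_plateau:
  fixes H :: "real \<Rightarrow> real"
  assumes "\<And>n x. (deriv ^^ n) H differentiable (at x)"
  shows "(deriv ^^ n) (\<lambda>x. H (k * (x - a)) - H (k * (x - b))) differentiable (at x)"
proof (rule smooth_if_in_deriv_closed_class)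
  define T where "T = {\<lambda>x. c * (deriv ^^ i) H (k * (x - a)) - c * (deriv ^^ i) H (k * (x - b)) | c i. True}"
  show "(\<lambda>x. H (k * (x - a)) - H (k * (x - b))) \<in> T"
    unfolding T_def by (intro CollectI exI[of _ 1] exI[of _ "0::nat"]) auto
  fix f assume "f \<in> T"
  then obtain c i where f: "f = (\<lambda>x. c * (deriv ^^ i) H (k * (x - a)) - c * (deriv ^^ i) H (k * (x - b)))"
    by (auto simp: T_def)
  have D: "((deriv ^^ i) H has_real_derivative (deriv ^^ Suc i) H y) (at y)" for y
    using assms[of i y] by (simp add: DERIV_deriv_iff_real_differentiable)
  show "\<exists>g\<in>T. \<forall>x. (f has_real_derivative g x) (at x)"
  proof (intro bexI allI)
    show "(\<lambda>x. (c * k) * (deriv ^^ Suc i) H (k * (x - a)) - (c * k) * (deriv ^^ Suc i) H (k * (x - b))) \<in> T"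
      unfolding T_def by blast
    show "(f has_real_derivative (c * k) * (deriv ^^ Suc i) H (k * (x - a)) - (c * k) * (deriv ^^ Suc i) H (k * (x - b))) (at x)" for x
      unfolding f by (auto intro!: derivative_eq_intros DERIV_chain2[OF D] simp del: funpow.simps)
  qed
qed


text \<open>Test the weak derivative with plateaus of increasing steepness. Their derivatives are approximate
  identities at \<open>a\<close> and \<open>b\<close>, and the plateaus themselves converge to the indicator of \<open>(a,b]\<close>.\<close>

lemma integral_weak_deriv:
  fixes f v :: "real \<Rightarrow> real"
  assumes w: "has_weak_deriv {l<..<u} f v" and cont: "continuous_on {l<..<u} f"
    and ab: "l < a" "a \<le> b" "b < u"
  shows "integral {a..b} v = f b - f a"
proof -
  obtain H \<eta> :: "real \<Rightarrow> real"
    where H: "\<And>x. (H has_real_derivative \<eta> x) (at x)" "continuous_on UNIV \<eta>"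
      "\<And>x. 0 \<le> \<eta> x" "\<And>x. x \<notin> {0<..<1} \<Longrightarrow> \<eta> x = 0"
      "\<And>x. x \<le> 0 \<Longrightarrow> H x = 0" "\<And>x. x \<ge> 1 \<Longrightarrow> H x = 1"
      and smooth: "\<And>n x. (deriv ^^ n) H differentiable (at x)"
    by (rule smooth_step_exists) (rule that; assumption)
  have H01: "0 \<le> H x" "H x \<le> 1" for x
  proof -
    have mono: "H y \<le> H z" if "y \<le> z" for y z
      by (rule DERIV_nonneg_imp_nondecreasing[OF that]) (use H in blast)
    show "0 \<le> H x" using mono[of "min x 0" x] H(5)[of "min x 0"] by simp
    show "H x \<le> 1" using mono[of x "max x 1"] H(6)[of "max x 1"] by simp
  qed
  define c where "c = (b + u) / 2"
  have c: "b < c" "c < u" using ab by (auto simp: c_def)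
  \<comment> \<open>The offset makes the falling edge, of width 1 / m, end before c for every n.\<close>
  define m where "m = (\<lambda>n::nat. real n + 1 / (c - b))"
  have m: "m n > 0" "m n * (c - b) \<ge> 1" for n
    using c by (auto simp: m_def distrib_right intro!: add_nonneg_pos)
  have m_lim: "filterlim m at_top sequentially"
    unfolding m_def by (rule filterlim_at_top_mono[OF filterlim_real_sequentially]) (use c in auto)
  define \<phi> where "\<phi> = (\<lambda>n x. H (m n * (x - a)) - H (m n * (x - b)))"
  define \<phi>' where "\<phi>' = (\<lambda>n x. m n * \<eta> (m n * (x - a)) - m n * \<eta> (m n * (x - b)))"
  have D: "(\<phi> n has_real_derivative \<phi>' n x) (at x)" for n x
    unfolding \<phi>_def \<phi>'_def 
    by (intro DERIV_diff; rule DERIV_chain2[OF H(1), THEN DERIV_cong]) (auto intro!: derivative_eq_intros)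
  have deriv: "deriv (\<phi> n) = \<phi>' n" for n using D by (intro ext DERIV_imp_deriv)
  have right: "m n * (x - b) \<ge> 1" "m n * (x - a) \<ge> 1" if "x > c" for n x
  proof -
    have "m n * (c - b) \<le> m n * (x - b)" "m n * (x - b) \<le> m n * (x - a)"
      using that m(1)[of n] ab by (auto intro: mult_left_mono)
    then show "m n * (x - b) \<ge> 1" "m n * (x - a) \<ge> 1" using m(2)[of n] by linarith+
  qed
  have left: "m n * (x - b) \<le> 0" "m n * (x - a) \<le> 0" if "x < a" for n x
    using that m(1)[of n] ab by (auto simp: mult_le_0_iff)
  have out: "\<phi> n x = 0 \<and> \<phi>' n x = 0" if "x \<notin> {a..c}" for n x
  proof (cases "x < a")
    case True
    then show ?thesis using left[OF True, of n] by (simp add: \<phi>_def \<phi>'_def H)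
  next
    case False
    then have "x > c" using that by simp
    from right[OF this, of n] show ?thesis by (simp add: \<phi>_def \<phi>'_def H)
  qed
  have sub: "{a..c} \<subseteq> {l<..<u}" using ab c by auto
  have fc: "continuous_on {a..c} f" using cont sub by (rule continuous_on_subset)
  have \<phi>c: "continuous_on S (\<phi> n)" for S n
    by (rule DERIV_continuous_on[OF has_field_derivative_at_within[OF D]])
  have \<eta>c: "continuous_on S (\<lambda>x. m n * \<eta> (m n * (x - p)))" for S n p
    by (intro continuous_intros continuous_on_compose2[OF H(2)]) auto
  have \<phi>'c: "continuous_on S (\<phi>' n)" for S n
    unfolding \<phi>'_def by (intro continuous_on_diff \<eta>c)
  have test: "test_function {l<..<u} (\<phi> n)" for n
  proof -
    have cl: "closure {x. \<phi> n x \<noteq> 0} \<subseteq> {a..c}"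
    proof (rule closure_minimal)
      show "{x. \<phi> n x \<noteq> 0} \<subseteq> {a..c}" using out[of _ n] by blast
    qed simp
    moreover have "compact (closure {x. \<phi> n x \<noteq> 0})"
      using cl compact_Icc[of a c] by (metis closed_closure compact_Int_closed inf.absorb2)
    moreover have "(deriv ^^ i) (\<phi> n) differentiable (at x)" for i x
      unfolding \<phi>_def by (rule smooth_plateau[OF smooth])
    ultimately show ?thesis unfolding test_function_def using sub by blast
  qed
  have va: "v absolutely_integrable_on {a..c}"
    using w ab c unfolding has_weak_deriv_def by (intro locally_integrableD) auto
  have eq: "integral {a..c} (\<lambda>x. f x * \<phi>' n x) = - integral {a..c} (\<lambda>x. v x * \<phi> n x)" for n
  proof -
    have "(LINT x:{l<..<u}|lebesgue. f x * \<phi>' n x) = - (LINT x:{l<..<u}|lebesgue. v x * \<phi> n x)"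
      using w test[of n] unfolding has_weak_deriv_def deriv[symmetric] by blast
    moreover have "(LINT x:{l<..<u}|lebesgue. f x * \<phi>' n x) = integral {a..c} (\<lambda>x. f x * \<phi>' n x)"
      by (subst set_lebesgue_integral_support(1)[OF sub])
         (use out in \<open>auto intro!: set_lebesgue_integral_eq_integral absolutely_integrable_continuous_real
            continuous_on_mult fc \<phi>'c\<close>)
    moreover have "(LINT x:{l<..<u}|lebesgue. v x * \<phi> n x) = integral {a..c} (\<lambda>x. v x * \<phi> n x)"
      by (subst set_lebesgue_integral_support(1)[OF sub])
         (use out in \<open>auto intro!: set_lebesgue_integral_eq_integral
            absolutely_integrable_mult_continuous va \<phi>c\<close>)
    ultimately show ?thesis by simp
  qed
  have "(\<lambda>n. integral {a..c} (\<lambda>x. f x * (m n * \<eta> (m n * (x - a))))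
           - integral {a..c} (\<lambda>x. f x * (m n * \<eta> (m n * (x - b))))) \<longlonglongrightarrow> f a - f b"
    using ab c by (intro tendsto_diff scaled_bump_integral_tendsto[OF fc _ _ H m_lim]) auto
  moreover have "integral {a..c} (\<lambda>x. f x * (m n * \<eta> (m n * (x - a))))
           - integral {a..c} (\<lambda>x. f x * (m n * \<eta> (m n * (x - b)))) = integral {a..c} (\<lambda>x. f x * \<phi>' n x)" for n
  proof -
    have i: "(\<lambda>x. f x * (m n * \<eta> (m n * (x - p)))) integrable_on {a..c}" for p
      by (intro integrable_continuous_interval continuous_on_mult fc \<eta>c)
    show ?thesis
      unfolding Henstock_Kurzweil_Integration.integral_diff[OF i i, symmetric]
      by (rule integral_cong) (simp only: \<phi>'_def right_diff_distrib)
  qed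
  ultimately have lim1: "(\<lambda>n. integral {a..c} (\<lambda>x. v x * \<phi> n x)) \<longlonglongrightarrow> - (f a - f b)"
    using tendsto_minus[of "\<lambda>n. integral {a..c} (\<lambda>x. f x * \<phi>' n x)" "f a - f b" sequentially] eq by simp
  have lim2: "(\<lambda>n. integral {a..c} (\<lambda>x. v x * \<phi> n x))
    \<longlonglongrightarrow> integral {a..c} (\<lambda>x. if x \<in> {a<..b} then v x else 0)"
  proof (rule dominated_convergence(2))
    show "(\<lambda>x. v x * \<phi> n x) integrable_on {a..c}" for n
      using absolutely_integrable_mult_continuous[OF va compact_Icc \<phi>c]
      by (simp add: absolutely_integrable_on_def)
    show "(\<lambda>x. \<bar>v x\<bar>) integrable_on {a..c}" using va by (simp add: absolutely_integrable_on_def)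
    show "norm (v x * \<phi> n x) \<le> \<bar>v x\<bar>" for n x
    proof -
      have "\<bar>\<phi> n x\<bar> \<le> 1"
        using H01[of "m n * (x - a)"] H01[of "m n * (x - b)"] by (simp add: \<phi>_def abs_le_iff)
      then show ?thesis by (simp add: abs_mult mult_left_le)
    qed
    show "(\<lambda>n. v x * \<phi> n x) \<longlonglongrightarrow> (if x \<in> {a<..b} then v x else 0)" if "x \<in> {a..c}" for x
    proof -
      have step: "\<forall>\<^sub>F n in sequentially. H (m n * (x - p)) = (if p < x then 1 else 0)" for p
      proof (cases "p < x")
        case True
        have "\<forall>\<^sub>F n in sequentially. 1 / (x - p) \<le> m n"
          using m_lim by (simp add: filterlim_at_top)
        then show ?thesis
        proof eventually_elim
          case (elim n)
          then show ?case using True by (simp add: H(6) field_simps)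
        qed
      next
        case False
        then have "H (m n * (x - p)) = 0" for n
          using m(1)[of n] by (intro H(5)) (simp add: mult_le_0_iff)
        then show ?thesis using False by simp
      qed
      have "\<forall>\<^sub>F n in sequentially. v x * \<phi> n x = (if x \<in> {a<..b} then v x else 0)"
        using step[of a] step[of b] by eventually_elim (use ab that in \<open>auto simp: \<phi>_def\<close>)
      then show ?thesis by (rule tendsto_eventually)
    qed
  qed
  have "integral {a..c} (\<lambda>x. if x \<in> {a<..b} then v x else 0)
      = integral {a..c} (\<lambda>x. if x \<in> {a..b} then v x else 0)"
    by (rule integral_spike[of "{a}"]) auto
  also have "\<dots> = integral {a..b} v"
    using c by (subst integral_restrict_Int) (simp add: Int_absorb1 inf_commute)
  finally show ?thesis using LIMSEQ_unique[OF lim1 lim2] by simp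
qed

lemma locally_integrable_add_cmult:
  assumes "locally_integrable S f" "locally_integrable S g"
  shows "locally_integrable S (\<lambda>x. f x + s * g x)"
  using assms unfolding locally_integrable_def by (auto intro: set_integral_add(1))

lemma weak_deriv_unique:
  fixes f v w :: "real \<Rightarrow> real"
  assumes v: "has_weak_deriv {l<..<u} f v" and w: "has_weak_deriv {l<..<u} f w"
    and cont: "continuous_on {l<..<u} f"
  shows "\<exists>N. negligible N \<and> (\<forall>x\<in>{l<..<u} - N. v x = w x)"
proof -
  have li: "locally_integrable {l<..<u} v" "locally_integrable {l<..<u} w"
    using v w by (auto simp: has_weak_deriv_def)
  have "\<exists>N. negligible N \<and> (\<forall>x\<in>{l<..<u} - N. v x + (-1) * w x = 0)"
  proof (rule eq_0_outside_negligible_if_integrals_0_open)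
    show "locally_integrable {l<..<u} (\<lambda>x. v x + (-1) * w x)"
      using li by (rule locally_integrable_add_cmult)
    fix x y assume xy: "l < x" "x \<le> y" "y < u"
    have "v integrable_on {x..y}" "w integrable_on {x..y}"
      using li xy by (auto dest!: locally_integrableD simp: absolutely_integrable_on_def)
    then show "integral {x..y} (\<lambda>x. v x + (-1) * w x) = 0"
      using integral_weak_deriv[OF v cont xy] integral_weak_deriv[OF w cont xy]
      by (simp add: Henstock_Kurzweil_Integration.integral_diff)
  qed
  then show ?thesis by simp
qed

lemma test_function_has_deriv:
  assumes "test_function S \<phi>"
  shows "(\<phi> has_real_derivative deriv \<phi> x) (at x)" "continuous_on A \<phi>" "continuous_on A (deriv \<phi>)"
proof -
  have d: "(deriv ^^ n) \<phi> differentiable (at x)" for n x using assms by (simp add: test_function_def)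
  show "(\<phi> has_real_derivative deriv \<phi> x) (at x)"
    using d[of 0] by (simp add: DERIV_deriv_iff_real_differentiable)
  show "continuous_on A \<phi>"
    using d[of 0] by (intro differentiable_imp_continuous_on differentiable_at_imp_differentiable_on) simp
  show "continuous_on A (deriv \<phi>)"
    using d[of 1] by (intro differentiable_imp_continuous_on differentiable_at_imp_differentiable_on) simp
qed

lemma integrable_mult_test_function:
  assumes \<phi>: "test_function S \<phi>" and f: "locally_integrable S f"
  shows "(\<lambda>x. f x * \<phi> x) absolutely_integrable_on S"
    and "(\<lambda>x. f x * deriv \<phi> x) absolutely_integrable_on S"
proof -
  define K where "K = closure {x. \<phi> x \<noteq> 0}"
  have K: "compact K" "K \<subseteq> S" using \<phi> by (auto simp: test_function_def K_def)
  have out: "\<phi> x = 0" if "x \<notin> K" for x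
    using that closure_subset[of "{x. \<phi> x \<noteq> 0}"] by (auto simp: K_def)
  have out': "deriv \<phi> x = 0" if "x \<notin> K" for x
  proof -
    have "((\<lambda>_. 0) has_real_derivative 0) (at x)" by simp
    then have "(\<phi> has_real_derivative 0) (at x)"
      by (rule has_field_derivative_transform_within_open[of _ _ _ "- K"])
         (use that out K in \<open>auto simp: compact_imp_closed open_Compl\<close>)
    then show ?thesis by (rule DERIV_imp_deriv)
  qed
  have fK: "f absolutely_integrable_on K" using f K by (simp add: locally_integrable_def)
  show "(\<lambda>x. f x * \<phi> x) absolutely_integrable_on S"
    using absolutely_integrable_mult_continuous[OF fK K(1) test_function_has_deriv(2)[OF \<phi>]]
    by (subst set_lebesgue_integral_support(2)[OF K(2)]) (auto simp: out)
  show "(\<lambda>x. f x * deriv \<phi> x) absolutely_integrable_on S"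
    using absolutely_integrable_mult_continuous[OF fK K(1) test_function_has_deriv(3)[OF \<phi>]]
    by (subst set_lebesgue_integral_support(2)[OF K(2)]) (auto simp: out')
qed

lemma has_weak_deriv_add_cmult:
  assumes f: "has_weak_deriv S f v" and g: "has_weak_deriv S g w"
  shows "has_weak_deriv S (\<lambda>x. f x + s * g x) (\<lambda>x. v x + s * w x)"
proof -
  have "(LINT x:S|lebesgue. (f x + s * g x) * deriv \<phi> x)
     = - (LINT x:S|lebesgue. (v x + s * w x) * \<phi> x)" if \<phi>: "test_function S \<phi>" for \<phi>
  proof -
    note i = integrable_mult_test_function[OF \<phi>]
    have "(LINT x:S|lebesgue. (f x + s * g x) * deriv \<phi> x)
       = (LINT x:S|lebesgue. f x * deriv \<phi> x + s * (g x * deriv \<phi> x))"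
      by (simp add: algebra_simps)
    also have "\<dots> = (LINT x:S|lebesgue. f x * deriv \<phi> x) + s * (LINT x:S|lebesgue. g x * deriv \<phi> x)"
      using f g by (subst set_integral_add(2)) (auto simp: has_weak_deriv_def intro!: i)
    also have "\<dots> = - ((LINT x:S|lebesgue. v x * \<phi> x) + s * (LINT x:S|lebesgue. w x * \<phi> x))"
      using f g \<phi> by (simp add: has_weak_deriv_def)
    also have "(LINT x:S|lebesgue. v x * \<phi> x) + s * (LINT x:S|lebesgue. w x * \<phi> x)
       = (LINT x:S|lebesgue. v x * \<phi> x + s * (w x * \<phi> x))"
      using f g by (subst set_integral_add(2)) (auto simp: has_weak_deriv_def intro!: i)
    also have "\<dots> = (LINT x:S|lebesgue. (v x + s * w x) * \<phi> x)"
      by (simp add: algebra_simps)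
    finally show ?thesis .
  qed
  then show ?thesis
    using f g by (simp add: has_weak_deriv_def locally_integrable_add_cmult)
qed

lemma has_weak_deriv_zero: "has_weak_deriv S (\<lambda>x. 0) (\<lambda>x. 0)"
  by (simp add: has_weak_deriv_def locally_integrable_def)

text \<open>The arbitrary choice in \<open>weak_deriv\<close> can thus be replaced, under integrals, by any known weak
  derivative.\<close>

lemma weak_deriv_eq_AE:
  assumes "has_weak_deriv {l<..<u} f v" "continuous_on {l<..<u} f"
  shows "\<exists>N. negligible N \<and> (\<forall>x\<in>{l<..<u} - N. weak_deriv {l<..<u} f x = v x)"
proof (rule weak_deriv_unique[OF _ assms])
  show "has_weak_deriv {l<..<u} f (weak_deriv {l<..<u} f)"
    unfolding weak_deriv_def by (rule someI[where P="has_weak_deriv {l<..<u} f", OF assms(1)])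
qed


section \<open>Bounded measurable functions\<close>

lemma locally_integrable_imp_measurable:
  fixes f :: "real \<Rightarrow> real"
  assumes "locally_integrable {l<..<u} f"
  shows "f \<in> borel_measurable (lebesgue_on {l<..<u})"
proof -
  define K where "K = (\<lambda>n::nat. {l + inverse (real (Suc n))..u - inverse (real (Suc n))})"
  have "(\<lambda>x. if x \<in> {l<..<u} then f x else 0) \<in> borel_measurable lebesgue"
  proof (rule borel_measurable_LIMSEQ_real)
    show "(\<lambda>x. indicator (K n) x *\<^sub>R f x) \<in> borel_measurable lebesgue" for n
    proof -
      have "f absolutely_integrable_on K n"
        unfolding K_def by (rule locally_integrableD[OF assms]) auto
      then show ?thesis unfolding set_integrable_def by (rule borel_measurable_integrable)
    qed
    show "(\<lambda>n. indicator (K n) x *\<^sub>R f x) \<longlonglongrightarrow> (if x \<in> {l<..<u} then f x else 0)" for x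
    proof (rule tendsto_eventually)
      show "\<forall>\<^sub>F n in sequentially. indicator (K n) x *\<^sub>R f x = (if x \<in> {l<..<u} then f x else 0)"
      proof (cases "x \<in> {l<..<u}")
        case True
        have "(\<lambda>n. inverse (real (Suc n))) \<longlonglongrightarrow> 0" by (rule LIMSEQ_inverse_real_of_nat)
        then have "\<forall>\<^sub>F n in sequentially. inverse (real (Suc n)) < min (x - l) (u - x)"
          by (rule order_tendstoD) (use True in auto)
        then show ?thesis by eventually_elim (use True in \<open>auto simp: K_def\<close>)
      next
        case False
        have "x \<notin> K n" for n
        proof -
          have "0 < inverse (real (Suc n))" by simp
          moreover have "l < x" "x < u" if "x \<in> K n" using that calculation by (simp_all only: K_def atLeastAtMost_iff) linarith+
          ultimately show ?thesis using False by auto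
        qed
        then have "indicator (K n) x *\<^sub>R f x = (if x \<in> {l<..<u} then f x else 0)" for n
          using False by (simp only: if_False) simp
        then show ?thesis by (intro always_eventually allI)
      qed
    qed
  qed
  then show ?thesis by (subst (asm) borel_measurable_if) auto
qed

text \<open>An algebra of functions, each integrable on a bounded interval; membership reduces the
  integrability of every coefficient of the energy expansion to closure properties.\<close>

definition bounded_measurable_on :: "real set \<Rightarrow> (real \<Rightarrow> real) \<Rightarrow> bool" where
  "bounded_measurable_on S f \<longleftrightarrow> f \<in> borel_measurable (lebesgue_on S) \<and> (\<exists>B. \<forall>x\<in>S. \<bar>f x\<bar> \<le> B)"

lemma bounded_measurable_on_const: "bounded_measurable_on S (\<lambda>x. c)"
  by (simp add: bounded_measurable_on_def exI[of _ "\<bar>c\<bar>"])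

lemma bounded_measurable_on_add:
  assumes "bounded_measurable_on S f" "bounded_measurable_on S g"
  shows "bounded_measurable_on S (\<lambda>x. f x + g x)"
proof -
  obtain B C where "\<And>x. x \<in> S \<Longrightarrow> \<bar>f x\<bar> \<le> B" "\<And>x. x \<in> S \<Longrightarrow> \<bar>g x\<bar> \<le> C"
    using assms by (auto simp: bounded_measurable_on_def)
  then have "\<bar>f x + g x\<bar> \<le> B + C" if "x \<in> S" for x
    using that by (intro order_trans[OF abs_triangle_ineq] add_mono) auto
  then show ?thesis using assms by (auto simp: bounded_measurable_on_def)
qed

lemma bounded_measurable_on_mult:
  assumes "bounded_measurable_on S f" "bounded_measurable_on S g"
  shows "bounded_measurable_on S (\<lambda>x. f x * g x)"
proof -
  obtain B C where "\<And>x. x \<in> S \<Longrightarrow> \<bar>f x\<bar> \<le> B" "\<And>x. x \<in> S \<Longrightarrow> \<bar>g x\<bar> \<le> C"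
    using assms by (auto simp: bounded_measurable_on_def)
  then have "\<bar>f x * g x\<bar> \<le> B * C" if "x \<in> S" for x
    unfolding abs_mult using that by (intro mult_mono) (auto intro: order_trans[OF abs_ge_zero])
  then show ?thesis using assms by (auto simp: bounded_measurable_on_def)
qed

lemma bounded_measurable_on_diff:
  assumes "bounded_measurable_on S f" "bounded_measurable_on S g"
  shows "bounded_measurable_on S (\<lambda>x. f x - g x)"
proof -
  have "bounded_measurable_on S (\<lambda>x. f x + (-1) * g x)"
    using assms by (intro bounded_measurable_on_add bounded_measurable_on_mult
      bounded_measurable_on_const)
  then show ?thesis by simp
qed

lemma bounded_measurable_on_power:
  assumes "bounded_measurable_on S f"
  shows "bounded_measurable_on S (\<lambda>x. f x ^ n)"
proof (induction n)
  case 0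
  show ?case using bounded_measurable_on_const[of S 1] by simp
next
  case (Suc n)
  show ?case using bounded_measurable_on_mult[OF assms Suc] by simp
qed

lemma bounded_measurable_on_continuous:
  fixes f :: "real \<Rightarrow> real"
  assumes "continuous_on {a<..<b} f" "\<And>x. x \<in> {a<..<b} \<Longrightarrow> \<bar>f x\<bar> \<le> B"
  shows "bounded_measurable_on {a<..<b} f"
  unfolding bounded_measurable_on_def
proof
  show "f \<in> borel_measurable (lebesgue_on {a<..<b})"
    using assms(1) by (rule continuous_imp_measurable_on_sets_lebesgue) simp
  show "\<exists>B. \<forall>x\<in>{a<..<b}. \<bar>f x\<bar> \<le> B" using assms(2) by blast
qed

lemma bounded_measurable_on_continuous_Icc:
  fixes f :: "real \<Rightarrow> real"
  assumes "continuous_on {a..b} f"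
  shows "bounded_measurable_on {a<..<b} f"
proof -
  have "bounded (f ` {a..b})" by (intro compact_imp_bounded compact_continuous_image assms) simp
  then obtain B where B: "\<And>x. x \<in> {a..b} \<Longrightarrow> \<bar>f x\<bar> \<le> B"
    by (auto simp: bounded_iff simp del: atLeastAtMost_iff)
  show ?thesis
    by (rule bounded_measurable_on_continuous[where B=B])
       (use B in \<open>auto intro: continuous_on_subset[OF assms]\<close>)
qed

lemma integrable_mult_bounded_measurable:
  assumes "bounded_measurable_on S f" "g absolutely_integrable_on S" "S \<in> sets lebesgue"
  shows "(\<lambda>x. f x * g x) absolutely_integrable_on S"
proof (rule absolutely_integrable_bounded_measurable_product_real)
  show "f \<in> borel_measurable (lebesgue_on S)" using assms(1) by (simp add: bounded_measurable_on_def)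
  obtain B where "\<forall>x\<in>S. \<bar>f x\<bar> \<le> B" using assms(1) unfolding bounded_measurable_on_def by blast
  then show "bounded (f ` S)" unfolding bounded_iff by (intro exI[of _ B]) simp
qed (fact assms)+

lemma bounded_measurable_imp_integrable:
  assumes "bounded_measurable_on {a<..<b} f"
  shows "f absolutely_integrable_on {a<..<b}"
proof -
  have "(\<lambda>x. 1::real) absolutely_integrable_on {a<..<b}"
    by (subst absolutely_integrable_on_Icc_iff_Ioo[symmetric])
       (rule absolutely_integrable_continuous_real, simp)
  from integrable_mult_bounded_measurable[OF assms this] show ?thesis by simp
qed

section \<open>The two variations of the energy\<close>

text \<open>Admissible directions at an element of \<open>W_h\<close>: piecewise differentiable functions that vanish at
  \<open>R\<close>, with \<open>w\<close> their derivative off a finite set. Boundedness of \<open>\<psi>\<close> and \<open>w\<close> makes the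
  norm finite.\<close>

definition variation :: "real \<Rightarrow> (real \<Rightarrow> real) \<Rightarrow> (real \<Rightarrow> real) \<Rightarrow> bool" where
  "variation R \<psi> w \<longleftrightarrow> continuous_on {0..R} \<psi> \<and> \<psi> R = 0 \<and> bounded_measurable_on {0<..<R} w \<and>
     (\<exists>S. finite S \<and> (\<forall>x\<in>{0<..<R} - S. (\<psi> has_real_derivative w x) (at x)))"

text \<open>Integration by parts survives finitely many exceptional points because \<open>\<psi>\<close> is continuous there.\<close>

lemma variation_has_weak_deriv:
  assumes var: "variation R \<psi> w" and R: "0 < R"
  shows "has_weak_deriv {0<..<R} \<psi> w"
proof -
  have \<psi>: "continuous_on {0..R} \<psi>" and R0: "\<psi> R = 0" and w: "bounded_measurable_on {0<..<R} w"
    using var by (auto simp: variation_def)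
  obtain S where S: "finite S" "\<And>x. x \<in> {0<..<R} - S \<Longrightarrow> (\<psi> has_real_derivative w x) (at x)"
    using var by (auto simp: variation_def)
  have li: "locally_integrable {0<..<R} f" if "bounded_measurable_on {0<..<R} f" for f
    using bounded_measurable_imp_integrable[OF that] unfolding locally_integrable_def
    by (auto intro: set_integrable_subset simp: compact_imp_closed)
  note l\<psi> = li[OF bounded_measurable_on_continuous_Icc[OF \<psi>]] and lw = li[OF w]
  have "(LINT x:{0<..<R}|lebesgue. \<psi> x * deriv \<phi> x) = - (LINT x:{0<..<R}|lebesgue. w x * \<phi> x)"
    if \<phi>: "test_function {0<..<R} \<phi>" for \<phi>
  proof -
    have "\<phi> 0 = 0"
    proof (rule ccontr)
      assume "\<phi> 0 \<noteq> 0"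
      then have "0 \<in> closure {x. \<phi> x \<noteq> 0}" using closure_subset[of "{x. \<phi> x \<noteq> 0}"] by (simp add: subset_iff)
      moreover have "closure {x. \<phi> x \<noteq> 0} \<subseteq> {0<..<R}" using \<phi> by (simp add: test_function_def)
      ultimately show False by auto
    qed
    have i: "(\<lambda>x. \<psi> x * deriv \<phi> x) absolutely_integrable_on {0<..<R}"
      "(\<lambda>x. w x * \<phi> x) absolutely_integrable_on {0<..<R}"
      by (rule integrable_mult_test_function(2)[OF \<phi> l\<psi>]) (rule integrable_mult_test_function(1)[OF \<phi> lw])
    have "((\<lambda>x. \<psi> x * deriv \<phi> x + w x * \<phi> x) has_integral \<psi> R * \<phi> R - \<psi> 0 * \<phi> 0) {0..R}"
    proof (rule fundamental_theorem_of_calculus_interior_strong[OF S(1)])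
      fix x assume x: "x \<in> {0<..<R} - S"
      show "((\<lambda>x. \<psi> x * \<phi> x) has_vector_derivative \<psi> x * deriv \<phi> x + w x * \<phi> x) (at x)"
        unfolding has_real_derivative_iff_has_vector_derivative[symmetric]
        by (rule DERIV_cong[OF DERIV_mult[OF S(2)[OF x] test_function_has_deriv(1)[OF \<phi>]]]) simp
    qed (use R \<psi> in \<open>auto intro!: continuous_on_mult test_function_has_deriv(2)[OF \<phi>]\<close>)
    then have "((\<lambda>x. \<psi> x * deriv \<phi> x + w x * \<phi> x) has_integral 0) {0<..<R}"
      using R0 \<open>\<phi> 0 = 0\<close> by (simp add: has_integral_Icc_iff_Ioo)
    moreover have "(LINT x:{0<..<R}|lebesgue. \<psi> x * deriv \<phi> x) + (LINT x:{0<..<R}|lebesgue. w x * \<phi> x)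
       = integral {0<..<R} (\<lambda>x. \<psi> x * deriv \<phi> x + w x * \<phi> x)"
      using set_integral_add[OF i] by (simp add: set_lebesgue_integral_eq_integral)
    ultimately show ?thesis by (simp add: integral_unique)
  qed
  then show ?thesis unfolding has_weak_deriv_def using l\<psi> lw by blast
qed

text \<open>Divide by \<open>s\<close> and let \<open>s\<close> tend to \<open>0\<close> from both sides to get \<open>a = 0\<close>; then divide by \<open>s\<^sup>2\<close>.\<close>

lemma polynomial_nonneg_near_0:
  fixes a b c d e :: real
  assumes e: "0 < e" and nn: "\<And>s. \<bar>s\<bar> < e \<Longrightarrow> 0 \<le> s * a + s^2 * b + s^3 * c + s^4 * d"
  shows "a = 0" and "0 \<le> b"
proof -
  have "((\<lambda>s. a + s * b + s^2 * c + s^3 * d) \<longlongrightarrow> a + 0 * b + 0^2 * c + 0^3 * d) (at (0::real) within S)" for S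
    by (intro tendsto_intros)
  then have lim: "((\<lambda>s. a + s * b + s^2 * c + s^3 * d) \<longlongrightarrow> a) (at 0 within S)" for S by simp
  have fac: "s * a + s^2 * b + s^3 * c + s^4 * d = s * (a + s * b + s^2 * c + s^3 * d)" for s
    by (simp add: algebra_simps power2_eq_square power3_eq_cube power4_eq_xxxx)
  have "\<forall>\<^sub>F s in at_right 0. s \<in> {0<..<e}" using e by (rule eventually_at_right_real)
  then have "\<forall>\<^sub>F s in at_right 0. 0 \<le> a + s * b + s^2 * c + s^3 * d"
  proof eventually_elim
    case (elim s)
    then have "0 \<le> s * (a + s * b + s^2 * c + s^3 * d)" using nn[of s] fac[of s] by simp
    with elim show ?case by (auto simp: zero_le_mult_iff)
  qed
  then have "0 \<le> a" by (rule tendsto_lowerbound[OF lim]) simp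
  moreover have "\<forall>\<^sub>F s in at_left 0. s \<in> {- e<..<0}"
    by (rule eventually_at_left_real) (use e in simp)
  then have "\<forall>\<^sub>F s in at_left 0. a + s * b + s^2 * c + s^3 * d \<le> 0"
  proof eventually_elim
    case (elim s)
    then have "0 \<le> s * (a + s * b + s^2 * c + s^3 * d)" using nn[of s] fac[of s] by simp
    with elim show ?case by (auto simp: zero_le_mult_iff)
  qed
  then have "a \<le> 0" by (rule tendsto_upperbound[OF lim]) simp
  ultimately show a: "a = 0" by simp
  have "((\<lambda>s. b + s * c + s^2 * d) \<longlongrightarrow> b + 0 * c + 0^2 * d) (at_right (0::real))"
    by (intro tendsto_intros)
  then have lim2: "((\<lambda>s. b + s * c + s^2 * d) \<longlongrightarrow> b) (at_right 0)" by simp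
  have fac2: "s * a + s^2 * b + s^3 * c + s^4 * d = s^2 * (b + s * c + s^2 * d)" for s
    by (simp add: a algebra_simps power2_eq_square power3_eq_cube power4_eq_xxxx)
  have "\<forall>\<^sub>F s in at_right 0. s \<in> {0<..<e}" using e by (rule eventually_at_right_real)
  then have "\<forall>\<^sub>F s in at_right 0. 0 \<le> b + s * c + s^2 * d"
  proof eventually_elim
    case (elim s)
    then have "0 \<le> s^2 * (b + s * c + s^2 * d)" using nn[of s] fac2[of s] by simp
    moreover have "0 < s^2" using elim by simp
    ultimately show ?case by (simp add: zero_le_mult_iff)
  qed
  then show "0 \<le> b" by (rule tendsto_lowerbound[OF lim2]) simp
qed

lemma W_norm_eq:
  assumes "has_weak_deriv {0<..<R} \<psi> w" "continuous_on {0<..<R} \<psi>"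
  shows "W_norm R \<psi> = sqrt ((LINT r:{0<..<R}|lebesgue. (\<psi> r)^2)
     + (LINT r:{0<..<R}|lebesgue. r^2 * (w r)^2))"
proof -
  obtain N where N: "negligible N" "\<And>x. x \<in> {0<..<R} - N \<Longrightarrow> weak_deriv {0<..<R} \<psi> x = w x"
    using weak_deriv_eq_AE[OF assms] by blast
  have "(LINT r:{0<..<R}|lebesgue. r^2 * (weak_deriv {0<..<R} \<psi> r)^2)
     = (LINT r:{0<..<R}|lebesgue. r^2 * (w r)^2)"
    by (rule set_lebesgue_integral_spike[OF N(1)]) (use N(2) in simp)
  then show ?thesis by (simp add: W_norm_def)
qed

text \<open>Writing \<open>r\<^sup>2 k'\<^sup>2\<close> as \<open>(r k')\<^sup>2\<close> and cancelling \<open>r\<^sup>2\<close> in the singular term leaves one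
  square-integrable quantity \<open>r k'\<close>, besides terms that are bounded whenever \<open>k\<close> is.\<close>

lemma energy_eq:
  assumes "has_weak_deriv {0<..<R} k v" "continuous_on {0<..<R} k"
  shows "energy R t k = (LINT r:{0<..<R}|lebesgue. 1/2 * (r * v r)^2 + 3 * (k r)^2 + r^2 * bulk t (k r))"
proof -
  obtain N where N: "negligible N" "\<And>x. x \<in> {0<..<R} - N \<Longrightarrow> weak_deriv {0<..<R} k x = v x"
    using weak_deriv_eq_AE[OF assms] by blast
  show ?thesis unfolding energy_def
  proof (rule set_lebesgue_integral_spike[OF N(1)])
    fix r assume r: "r \<in> {0<..<R} - N"
    then have "r \<noteq> 0" by simp
    then show "r^2 * (1 / 2 * \<bar>weak_deriv {0<..<R} k r\<bar>^2 + 3 * \<bar>k r\<bar>^2 / r^2 + bulk t (k r))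
      = 1/2 * (r * v r)^2 + 3 * (k r)^2 + r^2 * bulk t (k r)"
      by (simp add: N(2)[OF r] distrib_left power_mult_distrib)
  qed
qed


text \<open>Along \<open>h + s \<psi>\<close> the energy is exactly a polynomial in \<open>s\<close>, since \<open>g\<close> is a quartic. For small \<open>s\<close> the
  competitor is within the radius of local minimality, so the polynomial is minimal at \<open>s = 0\<close>: its
  linear coefficient vanishes and its quadratic coefficient is nonnegative. Boundedness of \<open>h\<close> makes
  all coefficients integrable.\<close>

lemma minimizer_variations:
  fixes h v \<psi> w :: "real \<Rightarrow> real"
  assumes R: "0 < R" and min: "local_minimizer R t h"
    and bnd: "\<And>r. r \<in> {0<..<R} \<Longrightarrow> \<bar>h r\<bar> \<le> M"
    and hv: "has_weak_deriv {0<..<R} h v"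
    and v2: "(\<lambda>r. r^2 * (v r)^2) absolutely_integrable_on {0<..<R}"
    and var: "variation R \<psi> w"
  shows "(\<lambda>r. r * v r) absolutely_integrable_on {0<..<R}"
    and "integral {0<..<R} (\<lambda>r. (r * w r) * (r * v r)
           + (6 * h r + r^2 * (t * h r - 3 * (h r)^2 + 2 * (h r)^3)) * \<psi> r) = 0"
    and "0 \<le> integral {0<..<R} (\<lambda>r. 1/2 * (r * w r)^2 + 3 * (\<psi> r)^2
           + r^2 * (t/2 - 3 * h r + 3 * (h r)^2) * (\<psi> r)^2)"
proof -
  let ?J = "{0<..<R}"
  have hW: "continuous_on {0<..R} h" "h R = h_plus t"
    using min by (simp_all add: local_minimizer_def W_h_def)
  obtain \<delta> where \<delta>: "0 < \<delta>" "\<And>k. k \<in> W_h R t \<Longrightarrow> W_norm R (\<lambda>r. k r - h r) < \<delta> \<Longrightarrow> energy R t h \<le> energy R t k"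
    using min unfolding local_minimizer_def by blast
  have \<psi>: "continuous_on {0..R} \<psi>" "\<psi> R = 0" and bw: "bounded_measurable_on ?J w"
    using var by (simp_all add: variation_def)
  have hc: "continuous_on ?J h" by (rule continuous_on_subset[OF hW(1)]) auto
  have \<psi>c: "continuous_on ?J \<psi>" by (rule continuous_on_subset[OF \<psi>(1)]) auto
  have bh: "bounded_measurable_on ?J h" using hc bnd by (rule bounded_measurable_on_continuous)
  have b\<psi>: "bounded_measurable_on ?J \<psi>" using \<psi>(1) by (rule bounded_measurable_on_continuous_Icc)
  have br: "bounded_measurable_on ?J (\<lambda>r. r)" by (rule bounded_measurable_on_continuous_Icc) simp
  note bm = bounded_measurable_on_add bounded_measurable_on_diff bounded_measurable_on_mult
    bounded_measurable_on_power bounded_measurable_on_const bw bh b\<psi> br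
  have J: "?J \<in> sets lebesgue" by simp
  have vm: "v \<in> borel_measurable (lebesgue_on ?J)"
    using hv unfolding has_weak_deriv_def by (intro locally_integrable_imp_measurable) blast
  have rv2: "(\<lambda>r. (r * v r)^2) absolutely_integrable_on ?J"
    using v2 by (simp add: power_mult_distrib)
  show rv: "(\<lambda>r. r * v r) absolutely_integrable_on ?J"
  proof (rule measurable_bounded_by_integrable_imp_absolutely_integrable)
    show "(\<lambda>r. r * v r) \<in> borel_measurable (lebesgue_on ?J)"
      using br vm unfolding bounded_measurable_on_def by (intro borel_measurable_times) blast+
    have "(\<lambda>r. 1 + (r * v r)^2) absolutely_integrable_on ?J"
      by (rule set_integral_add(1)[OF bounded_measurable_imp_integrable[OF bounded_measurable_on_const] rv2])
    then show "(\<lambda>r. 1 + (r * v r)^2) integrable_on ?J" by (rule set_lebesgue_integral_eq_integral)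
    \<comment> \<open>On a bounded interval a square-integrable function is integrable.\<close>
    show "norm (r * v r) \<le> 1 + (r * v r)^2" for r
      using sum_squares_bound[of 1 "\<bar>r * v r\<bar>"] zero_le_power2[of "r * v r"] unfolding real_norm_def power2_abs power_one
      by linarith
  qed simp
  have vw: "(\<lambda>r. (r * w r) * (r * v r)) absolutely_integrable_on ?J"
    by (rule integrable_mult_bounded_measurable[OF _ rv J]) (intro bm)
  define e where "e = (\<lambda>r. 1/2 * (r * v r)^2 + 3 * (h r)^2 + r^2 * bulk t (h r))"
  define \<alpha> where "\<alpha> = (\<lambda>r. (r * w r) * (r * v r) + (6 * h r + r^2 * (t * h r - 3 * (h r)^2 + 2 * (h r)^3)) * \<psi> r)"
  define \<beta> where "\<beta> = (\<lambda>r. 1/2 * (r * w r)^2 + 3 * (\<psi> r)^2 + r^2 * (t/2 - 3 * h r + 3 * (h r)^2) * (\<psi> r)^2)"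
  define \<gamma> where "\<gamma> = (\<lambda>r. r^2 * (2 * h r - 1) * (\<psi> r)^3)"
  define \<epsilon> where "\<epsilon> = (\<lambda>r. 1/2 * r^2 * (\<psi> r)^4)"
  have ie: "e absolutely_integrable_on ?J"
  proof -
    have "(\<lambda>r. 1/2 * (r * v r)^2) absolutely_integrable_on ?J" using rv2 by (rule set_integrable_mult_right)
    moreover have "(\<lambda>r. 3 * (h r)^2 + r^2 * bulk t (h r)) absolutely_integrable_on ?J"
      unfolding bulk_def by (rule bounded_measurable_imp_integrable) (intro bm)
    ultimately have "(\<lambda>r. 1/2 * (r * v r)^2 + (3 * (h r)^2 + r^2 * bulk t (h r))) absolutely_integrable_on ?J"
      by (rule set_integral_add(1))
    then show ?thesis by (simp only: e_def add.assoc)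
  qed
  have i\<alpha>: "\<alpha> absolutely_integrable_on ?J"
    unfolding \<alpha>_def by (rule set_integral_add(1)[OF vw bounded_measurable_imp_integrable]) (intro bm)
  have i\<beta>: "\<beta> absolutely_integrable_on ?J"
    unfolding \<beta>_def by (rule bounded_measurable_imp_integrable) (intro bm)
  have i\<gamma>: "\<gamma> absolutely_integrable_on ?J"
    unfolding \<gamma>_def by (rule bounded_measurable_imp_integrable) (intro bm)
  have i\<epsilon>: "\<epsilon> absolutely_integrable_on ?J"
    unfolding \<epsilon>_def by (rule bounded_measurable_imp_integrable) (intro bm)
  have \<psi>w: "has_weak_deriv ?J \<psi> w" using var R by (rule variation_has_weak_deriv)
  define k where "k = (\<lambda>s r. h r + s * \<psi> r)"
  have kw: "has_weak_deriv ?J (k s) (\<lambda>r. v r + s * w r)" for s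
    unfolding k_def using hv \<psi>w by (rule has_weak_deriv_add_cmult)
  have kc: "continuous_on ?J (k s)" for s
    unfolding k_def by (intro continuous_intros hc \<psi>c)
  have kW: "k s \<in> W_h R t" for s
  proof -
    have "continuous_on {0<..R} (k s)"
      unfolding k_def by (intro continuous_intros hW(1) continuous_on_subset[OF \<psi>(1)]) auto
    moreover have "(\<lambda>r. (k s r)^2) absolutely_integrable_on ?J"
      unfolding k_def by (rule bounded_measurable_imp_integrable) (intro bm)
    moreover have "(\<lambda>r. r^2 * (v r + s * w r)^2) absolutely_integrable_on ?J"
    proof -
      have "(\<lambda>r. (r * v r)^2 + (2 * s) * ((r * w r) * (r * v r)) + s^2 * (r * w r)^2) absolutely_integrable_on ?J"
      proof (intro set_integral_add(1) rv2)
        show "(\<lambda>r. (2 * s) * ((r * w r) * (r * v r))) absolutely_integrable_on ?J"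
          using vw by (rule set_integrable_mult_right)
        show "(\<lambda>r. s^2 * (r * w r)^2) absolutely_integrable_on ?J"
          by (rule bounded_measurable_imp_integrable) (intro bm)
      qed
      moreover have "(r * v r)^2 + (2 * s) * ((r * w r) * (r * v r)) + s^2 * (r * w r)^2
        = r^2 * (v r + s * w r)^2" for r
        by (simp add: power2_eq_square algebra_simps)
      ultimately show ?thesis by simp
    qed
    moreover have "k s R = h_plus t" using hW(2) \<psi>(2) by (simp add: k_def)
    ultimately show ?thesis unfolding W_h_def using kw[of s] by blast
  qed
  have norm: "W_norm R (\<lambda>r. k s r - h r) = \<bar>s\<bar> * W_norm R \<psi>" for s
  proof -
    have s\<psi>: "(\<lambda>r. k s r - h r) = (\<lambda>r. 0 + s * \<psi> r)" by (auto simp: k_def)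
    have "has_weak_deriv ?J (\<lambda>r. 0 + s * \<psi> r) (\<lambda>r. 0 + s * w r)"
      by (rule has_weak_deriv_add_cmult[OF has_weak_deriv_zero \<psi>w])
    then have "W_norm R (\<lambda>r. k s r - h r) = sqrt ((LINT r:?J|lebesgue. (0 + s * \<psi> r)^2)
       + (LINT r:?J|lebesgue. r^2 * (0 + s * w r)^2))"
      unfolding s\<psi> by (rule W_norm_eq) (intro continuous_intros \<psi>c)
    also have "\<dots> = sqrt (s^2 * ((LINT r:?J|lebesgue. (\<psi> r)^2) + (LINT r:?J|lebesgue. r^2 * (w r)^2)))"
    proof -
      have "(0 + s * \<psi> r)^2 = s^2 * (\<psi> r)^2" "r^2 * (0 + s * w r)^2 = s^2 * (r^2 * (w r)^2)" for r
        by (simp_all add: power_mult_distrib mult_ac)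
      then show ?thesis by (simp only: set_integral_mult_right distrib_left)
    qed
    also have "\<dots> = \<bar>s\<bar> * W_norm R \<psi>"
      by (simp add: real_sqrt_mult W_norm_eq[OF \<psi>w \<psi>c])
    finally show ?thesis .
  qed
  have energy: "energy R t (k s) = energy R t h + (s * integral ?J \<alpha> + s^2 * integral ?J \<beta>
      + s^3 * integral ?J \<gamma> + s^4 * integral ?J \<epsilon>)" for s
  proof -
    have "energy R t (k s) = (LINT r:?J|lebesgue. e r + (s * \<alpha> r + s^2 * \<beta> r + s^3 * \<gamma> r + s^4 * \<epsilon> r))"
      unfolding energy_eq[OF kw kc]
    proof (rule set_lebesgue_integral_cong, simp, safe)
      fix r
      have "r * (v r + s * w r) = r * v r + s * (r * w r)" by (simp add: algebra_simps)
      then have "(r * (v r + s * w r))^2 = (r * v r)^2 + 2 * s * ((r * w r) * (r * v r)) + s^2 * (r * w r)^2"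
        by (simp only:) (simp add: power2_eq_square algebra_simps)
      moreover have "(k s r)^2 = (h r)^2 + 2 * s * (h r * \<psi> r) + s^2 * (\<psi> r)^2"
        by (simp add: k_def power2_eq_square algebra_simps)
      moreover have "bulk t (k s r) = bulk t (h r) + s * ((t * h r - 3 * (h r)^2 + 2 * (h r)^3) * \<psi> r)
          + s^2 * ((t/2 - 3 * h r + 3 * (h r)^2) * (\<psi> r)^2) + s^3 * ((2 * h r - 1) * (\<psi> r)^3)
          + s^4 * (1/2 * (\<psi> r)^4)"
        by (simp add: k_def bulk_def field_simps power2_eq_square power3_eq_cube power4_eq_xxxx)
      ultimately show "1/2 * (r * (v r + s * w r))^2 + 3 * (k s r)^2 + r^2 * bulk t (k s r)
        = e r + (s * \<alpha> r + s^2 * \<beta> r + s^3 * \<gamma> r + s^4 * \<epsilon> r)"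
        by (simp only: e_def \<alpha>_def \<beta>_def \<gamma>_def \<epsilon>_def) (simp add: algebra_simps)
    qed
    also have "\<dots> = (LINT r:?J|lebesgue. e r) + (s * (LINT r:?J|lebesgue. \<alpha> r) + s^2 * (LINT r:?J|lebesgue. \<beta> r)
      + s^3 * (LINT r:?J|lebesgue. \<gamma> r) + s^4 * (LINT r:?J|lebesgue. \<epsilon> r))"
      by (simp only: set_integral_add set_integrable_mult_right ie i\<alpha> i\<beta> i\<gamma> i\<epsilon> set_integral_mult_right)
    also have "(LINT r:?J|lebesgue. e r) = energy R t h"
      unfolding energy_eq[OF hv hc] e_def ..
    finally show ?thesis
      by (simp only: set_lebesgue_integral_eq_integral(2) i\<alpha> i\<beta> i\<gamma> i\<epsilon>)
  qed
  have W0: "0 \<le> W_norm R \<psi>" unfolding W_norm_def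
    by (intro real_sqrt_ge_zero add_nonneg_nonneg)
       (auto simp: set_lebesgue_integral_def intro!: Bochner_Integration.integral_nonneg)
  define \<eta> where "\<eta> = \<delta> / (W_norm R \<psi> + 1)"
  have \<eta>: "0 < \<eta>" using \<delta>(1) W0 by (simp add: \<eta>_def)
  have pos: "0 \<le> s * integral ?J \<alpha> + s^2 * integral ?J \<beta> + s^3 * integral ?J \<gamma> + s^4 * integral ?J \<epsilon>"
    if "\<bar>s\<bar> < \<eta>" for s
  proof -
    have "\<bar>s\<bar> * W_norm R \<psi> \<le> \<bar>s\<bar> * (W_norm R \<psi> + 1)" by (rule mult_left_mono) auto
    also have "\<dots> < \<delta>" using that W0 by (simp add: \<eta>_def field_simps)
    finally have "energy R t h \<le> energy R t (k s)" by (intro \<delta>(2) kW) (simp add: norm)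
    then show ?thesis unfolding energy by simp
  qed
  show "integral ?J (\<lambda>r. (r * w r) * (r * v r)
           + (6 * h r + r^2 * (t * h r - 3 * (h r)^2 + 2 * (h r)^3)) * \<psi> r) = 0"
    using polynomial_nonneg_near_0(1)[OF \<eta> pos] by (simp only: \<alpha>_def)
  show "0 \<le> integral ?J (\<lambda>r. 1/2 * (r * w r)^2 + 3 * (\<psi> r)^2
           + r^2 * (t/2 - 3 * h r + 3 * (h r)^2) * (\<psi> r)^2)"
    using polynomial_nonneg_near_0(2)[OF \<eta> pos] by (simp only: \<beta>_def)
qed


section \<open>Regularity of minimizers\<close>

lemma bounded_measurable_on_indicator:
  assumes "A \<in> sets borel" "S \<in> sets lebesgue"
  shows "bounded_measurable_on S (indicator A)"
  unfolding bounded_measurable_on_def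
proof
  have "indicator A \<in> borel_measurable (borel :: real measure)" using assms(1) by simp
  then have "indicator A \<in> borel_measurable (lebesgue :: real measure)"
    by (intro measurable_completion) simp
  then show "indicator A \<in> borel_measurable (lebesgue_on S)" by (rule measurable_restrict_space1)
  show "\<exists>B. \<forall>x\<in>S. \<bar>indicator A x :: real\<bar> \<le> B" by (intro exI[of _ 1]) (auto split: split_indicator)
qed

text \<open>The direction rises with slope \<open>1 - c\<close> on \<open>[a,x]\<close> and falls with slope \<open>- c\<close> on \<open>[x,R]\<close>; the value
  of \<open>c\<close> is the one that brings it back to zero at \<open>R\<close>. Used in the first variation, it compares the
  mean of a function over \<open>[a,x]\<close> with its mean over \<open>[a,R]\<close>.\<close>

lemma hat_variation:
  fixes a x R :: real
  assumes x: "0 < a" "a \<le> x" "x \<le> R" "a < R"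
  defines "c \<equiv> (x - a) / (R - a)"
  shows "variation R (\<lambda>r. max 0 (min r x - a) - c * max 0 (r - a))
    (\<lambda>r. indicator {a<..x} r - c * indicator {a<..R} r)"
  unfolding variation_def
proof (intro conjI exI[of _ "{a, x}"] ballI)
  let ?\<psi> = "\<lambda>r. max 0 (min r x - a) - c * max 0 (r - a)"
  let ?w = "\<lambda>r. indicator {a<..x} r - c * indicator {a<..R} r"
  show "continuous_on {0..R} ?\<psi>" by (intro continuous_intros)
  show "?\<psi> R = 0" using x by (simp add: c_def)
  show "bounded_measurable_on {0<..<R} ?w"
    by (intro bounded_measurable_on_diff bounded_measurable_on_mult bounded_measurable_on_const
          bounded_measurable_on_indicator) auto
  fix r assume r: "r \<in> {0<..<R} - {a, x}"
  then consider "r < a" | "a < r" "r < x" | "x < r" using x by force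
  then show "(?\<psi> has_real_derivative ?w r) (at r)"
  proof cases
    case 1
    have "((\<lambda>_. 0) has_real_derivative 0) (at r)" by simp
    then have "(?\<psi> has_real_derivative 0) (at r)"
      by (rule has_field_derivative_transform_within_open[of _ _ _ "{..<a}"]) (use 1 in auto)
    then show ?thesis using 1 x by simp
  next
    case 2
    have "((\<lambda>r. (r - a) - c * (r - a)) has_real_derivative 1 - c) (at r)"
      by (auto intro!: derivative_eq_intros)
    then have "(?\<psi> has_real_derivative 1 - c) (at r)"
      by (rule has_field_derivative_transform_within_open[of _ _ _ "{a<..<x}"]) (use 2 in auto)
    then show ?thesis using 2 x by simp
  next
    case 3
    have "((\<lambda>r. (x - a) - c * (r - a)) has_real_derivative - c) (at r)"
      by (auto intro!: derivative_eq_intros)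
    then have "(?\<psi> has_real_derivative - c) (at r)"
      by (rule has_field_derivative_transform_within_open[of _ _ _ "{x<..}"]) (use 3 x in auto)
    then show ?thesis using 3 x r by simp
  qed
qed simp

text \<open>The lemma of du Bois-Reymond. Let \<open>G\<close> be a primitive of the right side \<open>F\<close> of the Euler-Lagrange
  equation and \<open>P = r\<^sup>2 v - G\<close>. The hat-shaped directions show that the mean of \<open>P\<close> over \<open>[a,x]\<close> does
  not depend on \<open>x\<close>, so \<open>P\<close> equals its mean \<open>m\<close> almost everywhere. Hence \<open>v = (m + G) / r\<^sup>2\<close> almost
  everywhere, and the right side is continuous up to \<open>R\<close>, so \<open>h\<close> is continuously differentiable with
  \<open>r\<^sup>2 h' = m + G\<close>.\<close>

lemma minimizer_regular_away_from_0:
  fixes h v :: "real \<Rightarrow> real"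
  assumes R: "0 < R" and min: "local_minimizer R t h"
    and bnd: "\<And>r. r \<in> {0<..<R} \<Longrightarrow> \<bar>h r\<bar> \<le> M"
    and hv: "has_weak_deriv {0<..<R} h v"
    and v2: "(\<lambda>r. r^2 * (v r)^2) absolutely_integrable_on {0<..<R}"
    and a: "0 < a" "a < R"
  defines "F \<equiv> \<lambda>r. 6 * h r + r^2 * (t * h r - 3 * (h r)^2 + 2 * (h r)^3)"
  shows "\<exists>u. \<forall>x\<in>{a..R}. (h has_real_derivative u x) (at x within {a..R})
      \<and> ((\<lambda>r. r^2 * u r) has_real_derivative F x) (at x within {a..R})"
proof -
  note mv = minimizer_variations[OF R min bnd hv v2]
  have "continuous_on {0<..R} h" using min by (simp add: local_minimizer_def W_h_def)
  then have hc: "continuous_on {a..R} h" by (rule continuous_on_subset) (use a in auto)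
  have Fc: "continuous_on {a..R} F" unfolding F_def by (intro continuous_intros hc)
  obtain G where G: "\<And>x. x \<in> {a..R} \<Longrightarrow> (G has_vector_derivative F x) (at x within {a..R})"
    using antiderivative_continuous[OF Fc] by blast
  have Gc: "continuous_on {a..R} G"
    using G by (intro continuous_on_vector_derivative) blast
  define P where "P = (\<lambda>r. (r * v r) * r - G r)"
  have "(\<lambda>r. r * v r) absolutely_integrable_on {0<..<R}"
    by (rule mv(1)[OF _ hat_variation[of a a R]]) (use a in auto)
  then have "(\<lambda>r. r * v r) absolutely_integrable_on {a<..<R}"
    by (rule set_integrable_subset) (use a in auto)
  then have "(\<lambda>r. r * v r) absolutely_integrable_on {a..R}"
    by (simp only: absolutely_integrable_on_Icc_iff_Ioo)
  then have "(\<lambda>r. (r * v r) * r) absolutely_integrable_on {a..R}"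
    by (rule absolutely_integrable_mult_continuous) (rule compact_Icc, rule continuous_on_id)
  then have Pa: "P absolutely_integrable_on {a..R}"
    unfolding P_def by (rule set_integral_diff(1)[OF _ absolutely_integrable_continuous_real[OF Gc]])
  then have Pi: "P integrable_on {a..R}" by (rule set_lebesgue_integral_eq_integral)
  have Pi_sub: "P integrable_on {x..y}" if "a \<le> x" "y \<le> R" for x y
    by (rule integrable_on_subinterval[OF Pi]) (use that in auto)
  define m where "m = integral {a..R} P / (R - a)"
  have mean: "integral {a..x} P = (x - a) * m" if x: "a \<le> x" "x \<le> R" for x
  proof -
    define c where "c = (x - a) / (R - a)"
    define \<psi> where "\<psi> = (\<lambda>r. max 0 (min r x - a) - c * max 0 (r - a))"
    define w :: "real \<Rightarrow> real" where "w = (\<lambda>r. indicator {a<..x} r - c * indicator {a<..R} r)"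
    have var: "variation R \<psi> w"
      unfolding \<psi>_def w_def c_def by (rule hat_variation) (use a x in auto)
    then have \<psi>c: "continuous_on {0..R} \<psi>" and \<psi>R: "\<psi> R = 0" by (simp_all add: variation_def)
    have \<psi>a: "\<psi> a = 0" using x by (simp add: \<psi>_def)
    obtain S where S: "finite S" "\<And>r. r \<in> {0<..<R} - S \<Longrightarrow> (\<psi> has_real_derivative w r) (at r)"
      using var unfolding variation_def by blast
    \<comment> \<open>Integrating (G \<psi>)' trades F \<psi> for - G w in the first variation.\<close>
    have "((\<lambda>r. F r * \<psi> r + G r * w r) has_integral G R * \<psi> R - G a * \<psi> a) {a..R}"
    proof (rule fundamental_theorem_of_calculus_interior_strong[OF S(1)])
      show "continuous_on {a..R} (\<lambda>r. G r * \<psi> r)"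
        by (intro continuous_on_mult Gc continuous_on_subset[OF \<psi>c]) (use a in auto)
      fix r assume r: "r \<in> {a<..<R} - S"
      have "(G has_vector_derivative F r) (at r within {a..R})" using G r by simp
      then have "(G has_real_derivative F r) (at r)"
        using r by (simp add: has_real_derivative_iff_has_vector_derivative at_within_Icc_at)
      from DERIV_mult[OF this S(2)] show "((\<lambda>r. G r * \<psi> r) has_vector_derivative F r * \<psi> r + G r * w r) (at r)"
        unfolding has_real_derivative_iff_has_vector_derivative[symmetric]
        using r a by (simp add: mult.commute add.commute)
    qed (use a in simp)
    then have I1: "((\<lambda>r. F r * \<psi> r + G r * w r) has_integral 0) {a..R}"
      by (simp add: \<psi>a \<psi>R)
    have "((\<lambda>r. (if r \<in> {a..x} then P r else 0) - c * P r) has_integral integral {a..x} P - c * integral {a..R} P) {a..R}"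
    proof (intro has_integral_diff has_integral_mult_right integrable_integral Pi)
      show "((\<lambda>r. if r \<in> {a..x} then P r else 0) has_integral integral {a..x} P) {a..R}"
        by (subst has_integral_restrict) (use x Pi_sub[of a x] in \<open>auto intro: integrable_integral\<close>)
    qed
    then have I2: "((\<lambda>r. P r * w r) has_integral integral {a..x} P - c * integral {a..R} P) {a..R}"
      by (rule has_integral_spike[of "{a}", rotated 2])
         (auto simp: w_def algebra_simps split: split_indicator)
    have "((\<lambda>r. (r * w r) * (r * v r) + F r * \<psi> r) has_integral integral {a..x} P - c * integral {a..R} P) {a..R}"
    proof -
      have "P r * w r + (F r * \<psi> r + G r * w r) = (r * w r) * (r * v r) + F r * \<psi> r" for r
        by (simp add: P_def algebra_simps)
      then show ?thesis using has_integral_add[OF I2 I1] by (simp only: add_0_right)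
    qed
    moreover have "((\<lambda>r. (r * w r) * (r * v r) + F r * \<psi> r) has_integral 0) {0..a}"
      by (rule has_integral_is_0) (use x in \<open>auto simp: w_def \<psi>_def\<close>)
    ultimately have "((\<lambda>r. (r * w r) * (r * v r) + F r * \<psi> r) has_integral
        0 + (integral {a..x} P - c * integral {a..R} P)) {0..R}"
      using a by (intro has_integral_combine[of 0 a R]) auto
    then have "((\<lambda>r. (r * w r) * (r * v r) + F r * \<psi> r) has_integral
        integral {a..x} P - c * integral {a..R} P) {0<..<R}"
      by (simp add: has_integral_Icc_iff_Ioo)
    then have "integral {a..x} P - c * integral {a..R} P = 0"
      using mv(2)[OF _ var] by (simp add: integral_unique F_def)
    then show ?thesis by (simp add: c_def m_def)
  qed
  have mean2: "integral {x..y} (\<lambda>r. P r - m) = 0" if xy: "a < x" "x \<le> y" "y < R" for x y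
  proof -
    have "integral {a..x} P + integral {x..y} P = integral {a..y} P"
      by (rule Henstock_Kurzweil_Integration.integral_combine) (use xy Pi_sub in auto)
    then have "integral {x..y} P = (y - x) * m" using mean[of x] mean[of y] xy by (simp add: algebra_simps)
    moreover have "integral {x..y} (\<lambda>r. P r - m) = integral {x..y} P - integral {x..y} (\<lambda>r. m)"
      by (rule Henstock_Kurzweil_Integration.integral_diff) (use xy Pi_sub in auto)
    ultimately show ?thesis using xy by simp
  qed
  have Pm: "(\<lambda>r. P r - m) absolutely_integrable_on {a..R}"
    by (intro set_integral_diff(1) Pa absolutely_integrable_continuous_real) simp
  have "locally_integrable {a<..<R} (\<lambda>r. P r - m)"
    unfolding locally_integrable_def
  proof (intro allI impI, rule set_integrable_subset[OF Pm])
    fix K assume K: "compact K \<and> K \<subseteq> {a<..<R}"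
    then show "K \<in> sets lebesgue" by (simp add: compact_imp_closed)
    show "K \<subseteq> {a..R}" using K by auto
  qed
  from eq_0_outside_negligible_if_integrals_0_open[OF this mean2]
  obtain N where N: "negligible N" "\<And>r. r \<in> {a<..<R} - N \<Longrightarrow> P r = m" by auto
  define u where "u = (\<lambda>r. (m + G r) / r^2)"
  have uc: "continuous_on {a..R} u" unfolding u_def by (intro continuous_intros Gc) (use a in auto)
  have vu: "v r = u r" if "r \<in> {a<..<R} - N" for r
  proof -
    have "v r * r^2 = m + G r" using N(2)[OF that] by (simp add: P_def power2_eq_square algebra_simps)
    then show ?thesis using that a by (simp add: u_def eq_divide_eq)
  qed
  obtain K where K: "\<And>x. x \<in> {a..R} \<Longrightarrow> (K has_vector_derivative u x) (at x within {a..R})"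
    using antiderivative_continuous[OF uc] by blast
  have Kc: "continuous_on {a..R} K" using K by (intro continuous_on_vector_derivative) blast
  have hc': "continuous_on {0<..<R} h"
    by (rule continuous_on_subset[OF \<open>continuous_on {0<..R} h\<close>]) auto
  have diff: "h y - K y = h x - K x" if xy: "a < x" "x \<le> y" "y < R" for x y
  proof -
    have "(u has_integral K y - K x) {x..y}"
      by (rule fundamental_theorem_of_calculus)
         (use xy in \<open>auto intro!: has_vector_derivative_within_subset[OF K]\<close>)
    moreover have "integral {x..y} v = integral {x..y} u"
      by (rule integral_spike[OF N(1)]) (use xy vu in auto)
    moreover have "integral {x..y} v = h y - h x"
      by (rule integral_weak_deriv[OF hv hc']) (use xy a in auto)
    ultimately show ?thesis by (simp add: integral_unique)
  qed
  define d where "d = h ((a + R) / 2) - K ((a + R) / 2)"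
  have d: "h x - K x = d" if "x \<in> {a<..<R}" for x
    using diff[of x "(a + R) / 2"] diff[of "(a + R) / 2" x] that a by (cases "x \<le> (a + R) / 2") (auto simp: d_def)
  have d': "h x - K x = d" if "x \<in> {a..R}" for x
  proof (rule continuous_constant_on_closure[of "{a<..<R}" "\<lambda>x. h x - K x"])
    show "continuous_on (closure {a<..<R}) (\<lambda>x. h x - K x)"
      using a by (simp add: continuous_on_diff hc Kc)
  qed (use d that a in auto)
  have "(h has_real_derivative u x) (at x within {a..R})
      \<and> ((\<lambda>r. r^2 * u r) has_real_derivative F x) (at x within {a..R})" if x: "x \<in> {a..R}" for x
  proof
    have "((\<lambda>x. K x + d) has_real_derivative u x) (at x within {a..R})"
      using K[OF x] by (simp add: has_real_derivative_iff_has_vector_derivative has_vector_derivative_add_const)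
    then show "(h has_real_derivative u x) (at x within {a..R})"
      by (rule has_field_derivative_transform_within[OF _ zero_less_one x]) (use d' in \<open>force simp: algebra_simps\<close>)
    have "((\<lambda>x. m + G x) has_real_derivative F x) (at x within {a..R})"
    proof -
      have "(G has_real_derivative F x) (at x within {a..R})"
        using G[OF x] by (simp add: has_real_derivative_iff_has_vector_derivative)
      from DERIV_add[OF DERIV_const[of m] this] show ?thesis by simp
    qed
    then show "((\<lambda>r. r^2 * u r) has_real_derivative F x) (at x within {a..R})"
      by (rule has_field_derivative_transform_within[OF _ zero_less_one x]) (use a in \<open>auto simp: u_def\<close>)
  qed
  then show ?thesis by (intro exI[of _ u] ballI)
qed

text \<open>The derivatives obtained on the intervals \<open>[a,R]\<close> agree on overlaps by uniqueness of the one-sided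
  derivative; at \<open>x\<close> the choice \<open>a = x / 2\<close> serves.\<close>

lemma minimizer_regular:
  fixes h v :: "real \<Rightarrow> real"
  assumes R: "0 < R" and min: "local_minimizer R t h"
    and bnd: "\<And>r. r \<in> {0<..<R} \<Longrightarrow> \<bar>h r\<bar> \<le> M"
    and hv: "has_weak_deriv {0<..<R} h v"
    and v2: "(\<lambda>r. r^2 * (v r)^2) absolutely_integrable_on {0<..<R}"
  defines "F \<equiv> \<lambda>r. 6 * h r + r^2 * (t * h r - 3 * (h r)^2 + 2 * (h r)^3)"
  obtains u where "\<And>x. x \<in> {0<..R} \<Longrightarrow> (h has_real_derivative u x) (at x within {0<..R})"
    and "\<And>x. x \<in> {0<..R} \<Longrightarrow> ((\<lambda>r. r^2 * u r) has_real_derivative F x) (at x within {0<..R})"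
proof -
  have at: "at x within {a..R} = at x within {0<..R}" if "0 < a" "a < x" for a x
    by (rule at_within_nhd[of _ "{a<..}"]) (use that in auto)
  have "\<exists>u. \<forall>x\<in>{a<..R}. (h has_real_derivative u x) (at x within {0<..R})
      \<and> ((\<lambda>r. r^2 * u r) has_real_derivative F x) (at x within {0<..R})" if a: "0 < a" "a < R" for a
  proof -
    obtain u where u: "\<And>x. x \<in> {a..R} \<Longrightarrow> (h has_real_derivative u x) (at x within {a..R})"
      "\<And>x. x \<in> {a..R} \<Longrightarrow> ((\<lambda>r. r^2 * u r) has_real_derivative F x) (at x within {a..R})"
      using minimizer_regular_away_from_0[OF R min bnd hv v2 a] unfolding F_def by blast
    show ?thesis
    proof (intro exI[of _ u] ballI)
      fix x assume "x \<in> {a<..R}"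
      then show "(h has_real_derivative u x) (at x within {0<..R})
        \<and> ((\<lambda>r. r^2 * u r) has_real_derivative F x) (at x within {0<..R})"
        using u[of x] at[OF a(1), of x] by simp
    qed
  qed
  then obtain U where U: "\<And>a x. 0 < a \<Longrightarrow> a < R \<Longrightarrow> x \<in> {a<..R} \<Longrightarrow> (h has_real_derivative U a x) (at x within {0<..R})"
    "\<And>a x. 0 < a \<Longrightarrow> a < R \<Longrightarrow> x \<in> {a<..R} \<Longrightarrow> ((\<lambda>r. r^2 * U a r) has_real_derivative F x) (at x within {0<..R})"
    by metis
  define u where "u = (\<lambda>x. U (x / 2) x)"
  have uU: "u x = U a x" if "0 < a" "a < x" "x \<le> R" for a x
  proof (rule vector_derivative_unique_within)
    have "x islimpt {0<..<x}" by (rule islimpt_greaterThanLessThan2) (use that in simp)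
    then have "x islimpt {0<..R}" by (rule islimpt_subset) (use that in auto)
    then show "at x within {0<..R} \<noteq> bot" by (simp add: trivial_limit_within)
    show "(h has_vector_derivative u x) (at x within {0<..R})"
      unfolding u_def has_real_derivative_iff_has_vector_derivative[symmetric] using that by (intro U) auto
    show "(h has_vector_derivative U a x) (at x within {0<..R})"
      unfolding has_real_derivative_iff_has_vector_derivative[symmetric] using that by (intro U) auto
  qed
  show ?thesis
  proof (rule that[of u])
    fix x assume x: "x \<in> {0<..R}"
    then show "(h has_real_derivative u x) (at x within {0<..R})"
      unfolding u_def by (intro U) auto
    have "((\<lambda>r. r^2 * U (x / 2) r) has_real_derivative F x) (at x within {0<..R})"
      using x by (intro U) auto
    then show "((\<lambda>r. r^2 * u r) has_real_derivative F x) (at x within {0<..R})"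
    proof (rule has_field_derivative_transform_within[of _ _ _ _ "x / 2"])
      fix y assume "y \<in> {0<..R}" "dist y x < x / 2"
      then have "x / 2 < y" "y \<le> R" by (auto simp: dist_real_def abs_if split: if_splits)
      then show "y^2 * U (x / 2) y = y^2 * u y" using x by (simp add: uU[of "x / 2" y])
    qed (use x in auto)
  qed
qed


section \<open>Monotonicity of stable solutions\<close>

text \<open>Together with its mirror image below, this isolates the interval around a negative value on which
  the function is nonpositive, with zeros at both ends.\<close>

lemma last_nonneg_before_negative:
  fixes f :: "real \<Rightarrow> real"
  assumes f: "continuous_on {a..b} f" and ab: "a \<le> b" "0 \<le> f a" "f b < 0"
  shows "\<exists>c. a \<le> c \<and> c < b \<and> f c = 0 \<and> (\<forall>x\<in>{c..b}. f x \<le> 0)"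
proof -
  define Z where "Z = {x \<in> {a..b}. f x \<ge> 0}"
  have "closed Z" unfolding Z_def
    using continuous_on_closed_Collect_le[of "{a..b}" "\<lambda>_. 0" f] f by simp
  have Z: "Z \<noteq> {}" "bdd_above Z" "\<And>x. x \<in> Z \<Longrightarrow> x \<le> b" using ab by (auto simp: Z_def)
  define c where "c = Sup Z"
  have "c \<in> Z" unfolding c_def using Z(1,2) \<open>closed Z\<close> by (rule closed_contains_Sup)
  then have c: "a \<le> c" "c \<le> b" "f c \<ge> 0" by (auto simp: Z_def)
  have after: "f x < 0" if "c < x" "x \<le> b" for x
  proof (rule ccontr)
    assume "\<not> f x < 0"
    then have "x \<in> Z" using that c by (simp add: Z_def)
    then have "x \<le> c" unfolding c_def using Z(2) by (rule cSup_upper)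
    with that show False by simp
  qed
  have "c \<noteq> b" using c(3) ab(3) by auto
  have fc: "f c = 0"
  proof -
    obtain x where x: "c \<le> x" "x \<le> b" "f x = 0"
      using IVT2'[of f b 0 c] c ab continuous_on_subset[OF f, of "{c..b}"] by auto
    then have "x = c" using after[of x] by (cases "c < x") auto
    then show ?thesis using x by simp
  qed
  show ?thesis
  proof (intro exI[of _ c] conjI ballI)
    show "c < b" using c \<open>c \<noteq> b\<close> by simp
    show "f x \<le> 0" if "x \<in> {c..b}" for x using after[of x] fc that by (cases "x = c") auto
  qed (use c fc in auto)
qed

lemma first_nonneg_after_negative:
  fixes f :: "real \<Rightarrow> real"
  assumes f: "continuous_on {a..b} f" and ab: "a \<le> b" "f a < 0" "0 \<le> f b"
  shows "\<exists>c. a < c \<and> c \<le> b \<and> f c = 0 \<and> (\<forall>x\<in>{a..c}. f x \<le> 0)"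
proof -
  have "continuous_on {- b..- a} (\<lambda>x. f (- x))"
    by (intro continuous_on_compose2[OF f] continuous_intros) auto
  from last_nonneg_before_negative[OF this] ab
  obtain c where c: "- b \<le> c" "c < - a" "f (- c) = 0" "\<And>x. x \<in> {c..- a} \<Longrightarrow> f (- x) \<le> 0" by auto
  have "f x \<le> 0" if "x \<in> {a..- c}" for x using c(4)[of "- x"] that by simp
  then show ?thesis using c(1-3) by (intro exI[of _ "- c"]) auto
qed

lemma at_within_Ioc_interior:
  fixes x :: real
  assumes "0 < x" "x < R"
  shows "at x within {0<..R} = at x"
  by (rule at_within_interior) (use assms interior_maximal[of "{0<..<R}" "{0<..R}"] in auto)

text \<open>What the monotonicity argument uses of a minimizer: the classical equation with \<open>u = h'\<close>, up to
  the one-sided derivative at \<open>R\<close>, the bounds on \<open>h\<close> with equality at \<open>R\<close>, and stability. The constant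
  \<open>hp\<close> stands for \<open>h\<^sub>+\<close>, a positive zero of \<open>g'\<close>.\<close>

locale radial_solution =
  fixes R t hp :: real and h u :: "real \<Rightarrow> real"
  assumes R: "0 < R" and hp: "0 < hp" and hp_root: "t * hp - 3 * hp^2 + 2 * hp^3 = 0"
    and h_nonneg: "\<And>r. r \<in> {0<..R} \<Longrightarrow> 0 \<le> h r"
    and h_le: "\<And>r. r \<in> {0<..R} \<Longrightarrow> h r \<le> hp"
    and h_R: "h R = hp"
    and h_deriv: "\<And>r. r \<in> {0<..R} \<Longrightarrow> (h has_real_derivative u r) (at r within {0<..R})"
    and flux_deriv: "\<And>r. r \<in> {0<..R} \<Longrightarrow> ((\<lambda>r. r^2 * u r) has_real_derivative
      6 * h r + r^2 * (t * h r - 3 * (h r)^2 + 2 * (h r)^3)) (at r within {0<..R})"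
    and stable: "\<And>\<psi> w. variation R \<psi> w \<Longrightarrow>
      0 \<le> integral {0<..<R} (\<lambda>r. 1/2 * (r * w r)^2 + 3 * (\<psi> r)^2
           + r^2 * (t/2 - 3 * h r + 3 * (h r)^2) * (\<psi> r)^2)"
begin

definition flux_rate :: "real \<Rightarrow> real" where
  "flux_rate r = 6 * h r + r^2 * (t * h r - 3 * (h r)^2 + 2 * (h r)^3)"

definition u' :: "real \<Rightarrow> real" where
  "u' r = flux_rate r / r^2 - 2 * u r / r"

lemma h_continuous: "continuous_on {0<..R} h"
  by (rule DERIV_continuous_on[OF h_deriv])

lemma flux_rate_continuous: "continuous_on {0<..R} flux_rate"
  unfolding flux_rate_def by (intro continuous_intros h_continuous)

lemma u_deriv_within:
  assumes r: "r \<in> {0<..R}"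
  shows "(u has_real_derivative u' r) (at r within {0<..R})"
proof -
  have "((\<lambda>r. r^2 * u r / r^2) has_real_derivative
     (flux_rate r * r^2 - r^2 * u r * (2 * r)) / (r^2 * r^2)) (at r within {0<..R})"
    by (rule DERIV_divide[OF flux_deriv[OF r, folded flux_rate_def]])
       (use r in \<open>auto intro!: derivative_eq_intros\<close>)
  moreover have "(flux_rate r * r^2 - r^2 * u r * (2 * r)) / (r^2 * r^2) = u' r"
    using r by (simp add: u'_def field_simps power2_eq_square)
  ultimately have "((\<lambda>r. r^2 * u r / r^2) has_real_derivative u' r) (at r within {0<..R})" by simp
  then show ?thesis
    by (rule has_field_derivative_transform_within[OF _ zero_less_one r]) auto
qed

lemma u_continuous: "continuous_on {0<..R} u"
  by (rule DERIV_continuous_on[OF u_deriv_within])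

lemma u'_continuous: "continuous_on {0<..R} u'"
  unfolding u'_def by (intro continuous_intros flux_rate_continuous u_continuous) auto

lemma interior_derivs:
  assumes "0 < r" "r < R"
  shows "(h has_real_derivative u r) (at r)" "(u has_real_derivative u' r) (at r)"
    "((\<lambda>r. r^2 * u r) has_real_derivative flux_rate r) (at r)"
    "(flux_rate has_real_derivative 6 * u r + 2 * r * (t * h r - 3 * (h r)^2 + 2 * (h r)^3)
        + r^2 * ((t - 6 * h r + 6 * (h r)^2) * u r)) (at r)"
proof -
  have r: "r \<in> {0<..R}" using assms by simp
  show h: "(h has_real_derivative u r) (at r)" "(u has_real_derivative u' r) (at r)"
    "((\<lambda>r. r^2 * u r) has_real_derivative flux_rate r) (at r)"
    using h_deriv[OF r] u_deriv_within[OF r] flux_deriv[OF r] at_within_Ioc_interior[OF assms]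
    by (simp_all add: flux_rate_def)
  show "(flux_rate has_real_derivative 6 * u r + 2 * r * (t * h r - 3 * (h r)^2 + 2 * (h r)^3)
        + r^2 * ((t - 6 * h r + 6 * (h r)^2) * u r)) (at r)"
    unfolding flux_rate_def
    by (rule derivative_eq_intros h(1) refl)+ (simp add: algebra_simps power2_eq_square)
qed

lemma flux_rate_factor: "flux_rate r = h r * (6 + r^2 * (t - 3 * h r + 2 * (h r)^2))"
  by (simp add: flux_rate_def algebra_simps power2_eq_square power3_eq_cube)

text \<open>The destabilizing direction is \<open>u\<close> on \<open>[r1,r2]\<close> and zero elsewhere; composing \<open>u\<close> with the
  projection onto \<open>[r1,r2]\<close> expresses it without case distinction. With \<open>p = r\<^sup>2 u'\<close>, the differentiated
  equation says that half of \<open>(u p)'\<close> is the second-variation density plus \<open>q = u\<^sup>2 - 6 h u / r\<close>. Its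
  integral is zero, so the second variation is minus the integral of \<open>q \<ge> u\<^sup>2\<close>.\<close>

lemma no_negative_well:
  assumes r: "0 < r1" "r1 < r0" "r0 < r2" "r2 \<le> R"
    and zero: "u r1 = 0" "u r2 = 0" and neg: "\<And>r. r \<in> {r1..r2} \<Longrightarrow> u r \<le> 0" "u r0 < 0"
  shows False
proof -
  have sub: "{r1..r2} \<subseteq> {0<..R}" using r by auto
  define cl where "cl = (\<lambda>r. max r1 (min r r2))"
  have cl: "cl r \<in> {r1..r2}" for r using r by (auto simp: cl_def)
  have clc: "continuous_on S cl" for S unfolding cl_def by (intro continuous_intros)
  define \<psi> where "\<psi> = (\<lambda>r. u (cl r))"
  define w where "w = (\<lambda>r. indicator {r1<..<r2} r * u' (cl r))"
  have comp: "continuous_on S (\<lambda>r. f (cl r))" if "continuous_on {0<..R} f" for f :: "real \<Rightarrow> real" and S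
    by (rule continuous_on_compose2[OF that clc]) (use cl sub in blast)
  have out: "\<psi> r = 0 \<and> w r = 0" if "r \<le> r1 \<or> r2 \<le> r" for r
    using that r zero by (auto simp: \<psi>_def w_def cl_def min_def max_def)
  have ins: "\<psi> r = u r \<and> w r = u' r" if "r1 < r" "r < r2" for r
    using that by (simp add: \<psi>_def w_def cl_def)
  have "variation R \<psi> w"
    unfolding variation_def
  proof (intro conjI exI[of _ "{r1, r2}"] ballI)
    show "continuous_on {0..R} \<psi>" unfolding \<psi>_def by (rule comp[OF u_continuous])
    show "\<psi> R = 0" using out[of R] r by simp
    show "bounded_measurable_on {0<..<R} w" unfolding w_def
      by (intro bounded_measurable_on_mult bounded_measurable_on_indicator
            bounded_measurable_on_continuous_Icc comp[OF u'_continuous]) auto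
    fix x assume x: "x \<in> {0<..<R} - {r1, r2}"
    then consider "x < r1" | "r1 < x" "x < r2" | "r2 < x" by force
    then show "(\<psi> has_real_derivative w x) (at x)"
    proof cases
      case 1
      have "((\<lambda>_. 0) has_real_derivative 0) (at x)" by simp
      then have "(\<psi> has_real_derivative 0) (at x)"
        by (rule has_field_derivative_transform_within_open[of _ _ _ "{..<r1}"]) (use 1 out in auto)
      then show ?thesis using 1 out[of x] by simp
    next
      case 2
      have "(u has_real_derivative u' x) (at x)" using x by (intro interior_derivs) auto
      then have "(\<psi> has_real_derivative u' x) (at x)"
        by (rule has_field_derivative_transform_within_open[of _ _ _ "{r1<..<r2}"]) (use 2 ins in auto)
      then show ?thesis using ins[OF 2] by simp
    next
      case 3
      have "((\<lambda>_. 0) has_real_derivative 0) (at x)" by simp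
      then have "(\<psi> has_real_derivative 0) (at x)"
        by (rule has_field_derivative_transform_within_open[of _ _ _ "{r2<..}"]) (use 3 out in auto)
      then show ?thesis using 3 out[of x] by simp
    qed
  qed simp
  note st = stable[OF this]
  define \<beta> where "\<beta> = (\<lambda>r. 1/2 * (r * w r)^2 + 3 * (\<psi> r)^2
           + r^2 * (t/2 - 3 * h r + 3 * (h r)^2) * (\<psi> r)^2)"
  define q where "q = (\<lambda>r. (u r)^2 - 6 * h r * u r / r)"
  have qc: "continuous_on {r1..r2} q"
    unfolding q_def
    by (intro continuous_intros continuous_on_subset[OF u_continuous sub] continuous_on_subset[OF h_continuous sub])
       (use r in auto)
  have q_ge: "(u r)^2 \<le> q r" if "r \<in> {r1..r2}" for r
  proof -
    have "h r * u r \<le> 0" using h_nonneg[of r] neg(1)[OF that] that sub by (intro mult_nonneg_nonpos) auto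
    then have "6 * h r * u r / r \<le> 0" using that r by (simp add: divide_nonpos_pos)
    then show ?thesis by (simp add: q_def)
  qed
  \<comment> \<open>This form of r^2 u' is differentiable without a third derivative of h.\<close>
  define p where "p = (\<lambda>r. flux_rate r - 2 * r * u r)"
  have p_u': "p r = r^2 * u' r" if "r \<in> {r1..r2}" for r
    using that r by (simp add: p_def u'_def field_simps power2_eq_square)
  have pc: "continuous_on {r1..r2} p"
    unfolding p_def
    by (intro continuous_intros continuous_on_subset[OF u_continuous sub] continuous_on_subset[OF flux_rate_continuous sub])
  have "((\<lambda>r. \<beta> r + q r) has_integral 1/2 * (u r2 * p r2) - 1/2 * (u r1 * p r1)) {r1..r2}"
  proof (rule fundamental_theorem_of_calculus_interior)
    show "continuous_on {r1..r2} (\<lambda>r. 1/2 * (u r * p r))"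
      by (intro continuous_intros pc continuous_on_subset[OF u_continuous sub])
    fix x assume x: "x \<in> {r1<..<r2}"
    then have x0: "0 < x" "x < R" using r by auto
    define g1 where "g1 = t * h x - 3 * (h x)^2 + 2 * (h x)^3"
    define g2 where "g2 = t - 6 * h x + 6 * (h x)^2"
    have pd: "(p has_real_derivative (6 * u x + 2 * x * g1 + x^2 * (g2 * u x)) - (2 * u x + 2 * x * u' x)) (at x)"
      unfolding p_def g1_def g2_def
      by (rule DERIV_diff[OF interior_derivs(4)[OF x0]])
         (auto intro!: derivative_eq_intros interior_derivs(2)[OF x0])
    have xu': "2 * x * u' x = 12 * h x / x + 2 * x * g1 - 4 * u x"
      using x0 by (simp add: u'_def flux_rate_def g1_def field_simps power2_eq_square)
    have "((\<lambda>r. 1/2 * (u r * p r)) has_real_derivative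
      1/2 * (u' x * p x + ((6 * u x + 2 * x * g1 + x^2 * (g2 * u x)) - (2 * u x + 2 * x * u' x)) * u x)) (at x)"
      by (intro DERIV_cmult DERIV_mult interior_derivs(2)[OF x0] pd)
    moreover have "1/2 * (u' x * p x + ((6 * u x + 2 * x * g1 + x^2 * (g2 * u x)) - (2 * u x + 2 * x * u' x)) * u x)
       = \<beta> x + q x"
    proof -
      have "\<beta> x + q x = 1/2 * (x * u' x)^2 + 3 * (u x)^2 + x^2 * (g2 / 2) * (u x)^2 + ((u x)^2 - 6 * h x * u x / x)"
        using ins[of x] x by (simp add: \<beta>_def q_def g2_def field_simps)
      moreover have "u' x * p x = (x * u' x)^2" using p_u'[of x] x by (simp add: power2_eq_square)
      ultimately show ?thesis unfolding xu' by (simp add: field_simps power2_eq_square)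
    qed
    ultimately show "((\<lambda>r. 1/2 * (u r * p r)) has_vector_derivative \<beta> x + q x) (at x)"
      by (simp only: has_real_derivative_iff_has_vector_derivative)
  qed (use r in auto)
  then have I1: "((\<lambda>r. \<beta> r + q r) has_integral 0) {r1..r2}" using zero by simp
  have qi: "(q has_integral integral {r1..r2} q) {r1..r2}"
    by (intro integrable_integral integrable_continuous_interval qc)
  have "(\<beta> has_integral - integral {r1..r2} q) {r1..r2}"
    using has_integral_diff[OF I1 qi] by simp
  moreover have "(\<beta> has_integral 0) {0..r1}" "(\<beta> has_integral 0) {r2..R}"
    by (auto intro!: has_integral_is_0 simp: \<beta>_def out)
  ultimately have "(\<beta> has_integral 0 + - integral {r1..r2} q + 0) {0..R}"
    using r by (intro has_integral_combine[of 0 r2 R] has_integral_combine[of 0 r1 r2]) auto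
  then have "integral {0<..<R} \<beta> = - integral {r1..r2} q"
    by (simp add: has_integral_Icc_iff_Ioo integral_unique)
  then have "integral {r1..r2} q \<le> 0" using st by (simp add: \<beta>_def)
  moreover have q0: "0 \<le> q r" if "r \<in> {r1..r2}" for r
    using q_ge[OF that] zero_le_power2[of "u r"] by linarith
  then have "0 \<le> integral {r1..r2} q"
    by (intro integral_nonneg integrable_continuous_interval qc) auto
  ultimately have "(q has_integral 0) (cbox r1 r2)" using qi by simp
  then have "q r0 = 0"
    by (rule has_integral_0_cbox_imp_0[of r1 r2 q, rotated 2]) (use qc q0 r in auto)
  moreover have "0 < (u r0)^2" using neg(2) by simp
  ultimately show False using q_ge[of r0] r by simp
qed

lemma u_R_nonneg: "0 \<le> u R"
proof (rule ccontr)
  assume "\<not> 0 \<le> u R"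
  then obtain d where d: "0 < d" "\<And>e. 0 < e \<Longrightarrow> R - e \<in> {0<..R} \<Longrightarrow> e < d \<Longrightarrow> h R < h (R - e)"
    using has_real_derivative_neg_dec_left[OF h_deriv[of R]] R by auto
  define e where "e = min d R / 2"
  have e: "0 < e" "e < d" "e < R" using d R by (auto simp: e_def)
  then have "h R < h (R - e)" by (intro d) auto
  then show False using h_le[of "R - e"] h_R e by auto
qed

text \<open>The right side of the equation is \<open>h (6 + r\<^sup>2 (t - 3 h + 2 h\<^sup>2))\<close>, nonnegative for small \<open>r\<close>. So a
  negative flux near \<open>0\<close> is bounded away from zero by some \<open>- m\<close>, and then \<open>h - m / r\<close> is nonincreasing,
  which forces \<open>h\<close> to blow up like \<open>m / r\<close>.\<close>

lemma nonneg_point_near_0: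
  assumes r0: "0 < r0" "r0 < R"
  shows "\<exists>r. 0 < r \<and> r < r0 \<and> 0 \<le> u r"
proof (rule ccontr)
  assume "\<not> ?thesis"
  then have neg: "u r < 0" if "0 < r" "r < r0" for r using that by (meson not_le)
  \<comment> \<open>Small enough for r^2 (|t| + 2) \<le> 6, where - |t| - 2 bounds t - 3 h + 2 h^2 from below.\<close>
  define \<rho> where "\<rho> = min (r0 / 2) (1 / (1 + \<bar>t\<bar>))"
  have \<rho>: "0 < \<rho>" "\<rho> < r0" "\<rho> < R" "\<rho> \<le> 1" "\<rho> * (1 + \<bar>t\<bar>) \<le> 1"
  proof -
    have "\<rho> \<le> r0 / 2" "\<rho> \<le> 1 / (1 + \<bar>t\<bar>)" by (simp_all add: \<rho>_def)
    moreover have "1 / (1 + \<bar>t\<bar>) \<le> 1" by simp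
    ultimately show "\<rho> < r0" "\<rho> < R" "\<rho> \<le> 1" using r0 by linarith+
    show "\<rho> * (1 + \<bar>t\<bar>) \<le> 1"
      using \<open>\<rho> \<le> 1 / (1 + \<bar>t\<bar>)\<close> by (simp add: pos_le_divide_eq add_pos_nonneg)
  qed (use r0 in \<open>simp add: \<rho>_def\<close>)
  have F0: "0 \<le> flux_rate r" if r: "0 < r" "r \<le> \<rho>" for r
  proof -
    have "2 * (h r)^2 - 3 * h r = 2 * (h r - 3/4)^2 - 9/8"
      by (simp add: power2_eq_square algebra_simps)
    then have "- \<bar>t\<bar> - 2 \<le> t - 3 * h r + 2 * (h r)^2"
      using zero_le_power2[of "h r - 3/4"] by linarith
    then have "r^2 * (- \<bar>t\<bar> - 2) \<le> r^2 * (t - 3 * h r + 2 * (h r)^2)"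
      by (rule mult_left_mono) simp
    moreover have "r^2 * (\<bar>t\<bar> + 2) \<le> 6"
    proof -
      have "r^2 \<le> \<rho>" using r \<rho> mult_mono[of r \<rho> r 1] by (simp add: power2_eq_square)
      then have "r^2 * (\<bar>t\<bar> + 2) \<le> \<rho> * (\<bar>t\<bar> + 2)" by (rule mult_right_mono) simp
      also have "\<dots> = \<rho> * (1 + \<bar>t\<bar>) + \<rho>" by (simp add: algebra_simps)
      finally show ?thesis using \<rho> by linarith
    qed
    ultimately have "0 \<le> 6 + r^2 * (t - 3 * h r + 2 * (h r)^2)" by (simp add: algebra_simps)
    then show ?thesis using h_nonneg[of r] r \<rho> by (simp add: flux_rate_factor)
  qed
  define m where "m = - (\<rho>^2 * u \<rho>)"
  have m: "0 < m" using neg[of \<rho>] \<rho> by (simp add: m_def mult_pos_neg)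
  have u_le: "u r \<le> - m / r^2" if r: "0 < r" "r \<le> \<rho>" for r
  proof -
    have "r^2 * u r \<le> \<rho>^2 * u \<rho>"
    proof (rule DERIV_nonneg_imp_nondecreasing[of r \<rho> "\<lambda>r. r^2 * u r"])
      fix x assume "r \<le> x" "x \<le> \<rho>"
      then show "\<exists>y. ((\<lambda>r. r^2 * u r) has_real_derivative y) (at x) \<and> 0 \<le> y"
        using interior_derivs(3)[of x] F0[of x] r \<rho> by (intro exI[of _ "flux_rate x"]) simp
    qed (use r in simp)
    then show ?thesis using r by (simp add: m_def field_simps)
  qed
  have blow: "h \<rho> - m / \<rho> \<le> h r - m / r" if r: "0 < r" "r \<le> \<rho>" for r
  proof (rule DERIV_nonpos_imp_nonincreasing[of r \<rho> "\<lambda>r. h r - m / r"])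
    fix x assume x: "r \<le> x" "x \<le> \<rho>"
    have "((\<lambda>r. h r - m / r) has_real_derivative u x + m / x^2) (at x)"
      using x r \<rho> by (auto intro!: derivative_eq_intros interior_derivs(1) simp: power2_eq_square)
    moreover have "u x + m / x^2 \<le> 0" using u_le[of x] x r by simp
    ultimately show "\<exists>y. ((\<lambda>r. h r - m / r) has_real_derivative y) (at x) \<and> y \<le> 0" by blast
  qed (use r in simp)
  \<comment> \<open>Chosen so that m / r exceeds hp + m / \<rho>, hence h r > hp.\<close>
  define r where "r = min \<rho> (m / (hp + m / \<rho> + 1))"
  have den: "0 < hp + m / \<rho> + 1" using hp m \<rho> by (simp add: add_pos_pos)
  have r: "0 < r" "r \<le> \<rho>" "r \<le> m / (hp + m / \<rho> + 1)" using den m \<rho> by (auto simp: r_def)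
  have "hp + m / \<rho> + 1 \<le> m / r" using r den by (simp add: field_simps)
  then have "hp + 1 \<le> h r" using blow[OF r(1,2)] h_nonneg[of \<rho>] \<rho> by auto
  then show False using h_le[of r] r \<rho> by auto
qed

lemma u_nonneg:
  assumes "r0 \<in> {0<..R}"
  shows "0 \<le> u r0"
proof (rule ccontr)
  assume "\<not> 0 \<le> u r0"
  then have neg: "u r0 < 0" by simp
  then have r0: "0 < r0" "r0 < R" using assms u_R_nonneg by (auto simp: less_le)
  obtain r where r: "0 < r" "r < r0" "0 \<le> u r" using nonneg_point_near_0[OF r0] by blast
  have c1: "continuous_on {r..r0} u" by (rule continuous_on_subset[OF u_continuous]) (use r r0 in auto)
  have c2: "continuous_on {r0..R} u" by (rule continuous_on_subset[OF u_continuous]) (use r r0 in auto)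
  obtain r1 where r1: "r \<le> r1" "r1 < r0" "u r1 = 0" "\<And>x. x \<in> {r1..r0} \<Longrightarrow> u x \<le> 0"
    using last_nonneg_before_negative[OF c1] r neg by auto
  obtain r2 where r2: "r0 < r2" "r2 \<le> R" "u r2 = 0" "\<And>x. x \<in> {r0..r2} \<Longrightarrow> u x \<le> 0"
    using first_nonneg_after_negative[OF c2] r0 neg u_R_nonneg by auto
  show False
  proof (rule no_negative_well[of r1 r0 r2])
    show "u x \<le> 0" if "x \<in> {r1..r2}" for x using r1(4)[of x] r2(4)[of x] that by (cases "x \<le> r0") auto
  qed (use r r1 r2 neg in auto)
qed

lemma h_mono:
  assumes "0 < x" "x \<le> y" "y \<le> R"
  shows "h x \<le> h y"
proof (rule DERIV_nonneg_imp_increasing_open[of x y h])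
  show "\<exists>z. (h has_real_derivative z) (at r) \<and> 0 \<le> z" if "x < r" "r < y" for r
    using interior_derivs(1)[of r] u_nonneg[of r] that assms by auto
  show "continuous_on {x..y} h" by (rule continuous_on_subset[OF h_continuous]) (use assms in auto)
qed (use assms in simp)

text \<open>Uniqueness for the equation with zero data, by a Gronwall-type estimate: \<open>h\<close> is nondecreasing and
  the right side is at most \<open>C h\<close>, so integrating twice over \<open>[s, s + d]\<close> bounds \<open>h (s + d)\<close> by
  \<open>d\<^sup>2 C / s\<^sup>2\<close> times itself, and this factor is below \<open>1\<close> for small \<open>d\<close>.\<close>

lemma h_zero_extends:
  assumes s: "0 < s" "s < R" "h s = 0"
  shows "\<exists>r>s. r \<le> R \<and> h r = 0"
proof -
  define C where "C = 6 + R^2 * (\<bar>t\<bar> + 2 * hp^2)"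
  have C: "0 < C" using hp by (simp add: C_def add_pos_nonneg)
  have us: "u s = 0"
  proof (rule DERIV_local_min[OF interior_derivs(1)[OF s(1,2)]])
    show "0 < min s (R - s)" using s by simp
    show "\<forall>y. \<bar>s - y\<bar> < min s (R - s) \<longrightarrow> h s \<le> h y"
    proof (intro allI impI)
      fix y assume "\<bar>s - y\<bar> < min s (R - s)"
      then have "y \<in> {0<..R}" by (auto simp: abs_if split: if_splits)
      then show "h s \<le> h y" using h_nonneg s(3) by simp
    qed
  qed
  have F_le: "flux_rate r \<le> C * h r" if r: "0 < r" "r \<le> R" for r
  proof -
    have hr: "0 \<le> h r" "h r \<le> hp" using h_nonneg h_le r by auto
    have "(h r)^2 \<le> hp^2" using hr by (intro power_mono) auto
    then have "t - 3 * h r + 2 * (h r)^2 \<le> \<bar>t\<bar> + 2 * hp^2" using hr by linarith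
    then have "r^2 * (t - 3 * h r + 2 * (h r)^2) \<le> r^2 * (\<bar>t\<bar> + 2 * hp^2)" by (rule mult_left_mono) simp
    also have "\<dots> \<le> R^2 * (\<bar>t\<bar> + 2 * hp^2)" using r by (intro mult_right_mono power_mono) auto
    finally have "6 + r^2 * (t - 3 * h r + 2 * (h r)^2) \<le> C" by (simp add: C_def)
    from mult_left_mono[OF this hr(1)] show ?thesis
      unfolding flux_rate_factor by (simp only: mult.commute[of C])
  qed
  define d where "d = min (R - s) (s / (C + 1)) / 2"
  have d: "0 < d" "s + d < R" "d * (C + 1) < s"
  proof -
    have e: "0 < min (R - s) (s / (C + 1))" using s C by simp
    have le: "2 * d \<le> R - s" "2 * d \<le> s / (C + 1)" by (simp_all add: d_def)
    show d0: "0 < d" using e by (simp add: d_def)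
    show "s + d < R" using le d0 by linarith
    have "2 * d * (C + 1) \<le> s" using le C by (simp add: pos_le_divide_eq)
    moreover have "0 < d * (C + 1)" using d0 C by simp
    ultimately show "d * (C + 1) < s" by linarith
  qed
  have u_le: "u x \<le> d * C * h (s + d) / s^2" if x: "s < x" "x < s + d" for x
  proof -
    obtain z where z: "s < z" "z < x" "x^2 * u x - s^2 * u s = (x - s) * flux_rate z"
      using MVT2[of s x "\<lambda>r. r^2 * u r" flux_rate] interior_derivs(3) x s d by auto
    have "flux_rate z \<le> C * h (s + d)"
    proof -
      have "flux_rate z \<le> C * h z" using F_le z x s d by auto
      also have "\<dots> \<le> C * h (s + d)" using h_mono[of z "s + d"] z x s d C by (intro mult_left_mono) auto
      finally show ?thesis .
    qed
    moreover have "0 \<le> C * h (s + d)" using C h_nonneg[of "s + d"] s d by auto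
    ultimately have "(x - s) * flux_rate z \<le> d * (C * h (s + d))" using x
      by (intro order_trans[OF mult_left_mono[of "flux_rate z" "C * h (s + d)" "x - s"] mult_right_mono]) auto
    then have "x^2 * u x \<le> d * C * h (s + d)" using z us by simp
    moreover have "s^2 * u x \<le> x^2 * u x"
      using u_nonneg[of x] x s d by (intro mult_right_mono power_mono) auto
    ultimately have "s^2 * u x \<le> d * C * h (s + d)" by linarith
    then show ?thesis using s by (simp add: field_simps)
  qed
  have "h (s + d) \<le> d * (d * C * h (s + d) / s^2)"
  proof -
    obtain z where z: "s < z" "z < s + d" "h (s + d) - h s = (s + d - s) * u z"
      using MVT2[of s "s + d" h u] interior_derivs(1) s d by auto
    then have "h (s + d) = d * u z" using s by simp
    also have "\<dots> \<le> d * (d * C * h (s + d) / s^2)" using u_le[OF z(1,2)] d by (intro mult_left_mono) auto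
    finally show ?thesis .
  qed
  moreover have "d^2 * C < s^2"
  proof -
    have "d * C \<le> d * (C + 1)" "d \<le> d * (C + 1)" using d C by (auto simp: algebra_simps)
    then have "d * C < s" "d < s" using d by linarith+
    then have "d * (d * C) < s * s" using d C by (intro mult_strict_mono') auto
    then show ?thesis by (simp add: power2_eq_square mult.assoc)
  qed
  moreover have "0 \<le> h (s + d)" using h_nonneg[of "s + d"] s d by auto
  ultimately have "h (s + d) = 0"
  proof -
    have "h (s + d) * s^2 \<le> d^2 * C * h (s + d)"
      using \<open>h (s + d) \<le> d * (d * C * h (s + d) / s^2)\<close> s by (simp add: field_simps power2_eq_square)
    then have "h (s + d) * (s^2 - d^2 * C) \<le> 0" by (simp add: algebra_simps)
    then show ?thesis using \<open>d^2 * C < s^2\<close> \<open>0 \<le> h (s + d)\<close> by (auto simp: mult_le_0_iff)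
  qed
  then show ?thesis using d s by (intro exI[of _ "s + d"]) auto
qed

text \<open>Otherwise consider the last zero of \<open>h\<close>: it is not \<open>R\<close>, and zeros extend to the right.\<close>

lemma h_pos:
  assumes x: "x \<in> {0<..R}"
  shows "0 < h x"
proof (rule ccontr)
  assume "\<not> 0 < h x"
  then have hx: "h x = 0" using h_nonneg[OF x] by simp
  define Z where "Z = {r \<in> {x..R}. h r = 0}"
  have hc: "continuous_on {x..R} h" by (rule continuous_on_subset[OF h_continuous]) (use x in auto)
  have "closed Z" unfolding Z_def using continuous_closed_preimage_constant[OF hc, of 0] by simp
  have Z: "x \<in> Z" "bdd_above Z" using hx x by (auto simp: Z_def)
  define s where "s = Sup Z"
  have "s \<in> Z" unfolding s_def using Z \<open>closed Z\<close> by (intro closed_contains_Sup) auto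
  then have s: "x \<le> s" "s \<le> R" "h s = 0" by (auto simp: Z_def)
  have "s \<noteq> R" using s h_R hp by auto
  then obtain r where r: "s < r" "r \<le> R" "h r = 0" using h_zero_extends[of s] s x by auto
  then have "r \<in> Z" using s by (simp add: Z_def)
  then have "r \<le> s" unfolding s_def using Z(2) by (rule cSup_upper)
  with r show False by simp
qed

text \<open>At a zero of \<open>u\<close> the flux \<open>r\<^sup>2 u \<ge> 0\<close> has a minimum, which contradicts its first derivative at \<open>R\<close>
  and its second derivative in the interior.\<close>

lemma u_pos:
  assumes x: "x \<in> {0<..R}"
  shows "0 < u x"
proof (rule ccontr)
  assume "\<not> 0 < u x"
  then have ux: "u x = 0" using u_nonneg[OF x] by simp
  show False
  proof (cases "x = R")
    case True
    have "flux_rate R = 6 * hp" using hp_root by (simp add: flux_rate_def h_R)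
    then have "((\<lambda>r. r^2 * u r) has_real_derivative 6 * hp) (at R within {0<..R})"
      using flux_deriv[of R] R by (simp add: flux_rate_def)
    from has_real_derivative_pos_inc_left[OF this] hp
    obtain d where d: "0 < d" "\<And>e. 0 < e \<Longrightarrow> R - e \<in> {0<..R} \<Longrightarrow> e < d \<Longrightarrow> (R - e)^2 * u (R - e) < R^2 * u R"
      by auto
    define e where "e = min d R / 2"
    have e: "0 < e" "e < d" "e < R" using d R by (auto simp: e_def)
    then have "(R - e)^2 * u (R - e) < R^2 * u R" by (intro d) auto
    moreover have "0 \<le> (R - e)^2 * u (R - e)" using u_nonneg[of "R - e"] e by auto
    ultimately show False using ux True by simp
  next
    case False
    then have x0: "0 < x" "x < R" using x by auto
    define d where "d = min x (R - x)"
    have d: "0 < d" using x0 by (simp add: d_def)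
    have near: "0 \<le> y^2 * u y" if "\<bar>x - y\<bar> < d" for y
      using u_nonneg[of y] that by (auto simp: d_def abs_if split: if_splits)
    have Fx: "flux_rate x = 0"
      by (rule DERIV_local_min[OF interior_derivs(3)[OF x0] d]) (use near ux in auto)
    define g1 where "g1 = t * h x - 3 * (h x)^2 + 2 * (h x)^3"
    have g1: "x^2 * g1 = - 6 * h x" using Fx by (simp add: flux_rate_def g1_def)
    have "0 < x^2" "- 6 * h x < 0" using x0 h_pos[OF x] by auto
    then have "g1 < 0" using g1 by (metis mult_less_0_iff not_less_iff_gr_or_eq)
    then have "2 * x * g1 < 0" using x0 by (simp add: mult_pos_neg)
    moreover have "(flux_rate has_real_derivative 2 * x * g1) (at x)"
      using interior_derivs(4)[OF x0] ux by (simp add: g1_def)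
    ultimately obtain e where e: "0 < e" "\<And>h. 0 < h \<Longrightarrow> h < e \<Longrightarrow> flux_rate (x + h) < flux_rate x"
      using DERIV_neg_dec_right by blast
    define y where "y = x + min d e / 2"
    have y: "x < y" "y < x + d" "y < x + e" "y < R"
    proof -
      have "0 < min d e" "min d e \<le> d" "min d e \<le> e" "d \<le> R - x" using d e(1) by (auto simp: d_def)
      then show "x < y" "y < x + d" "y < x + e" "y < R" unfolding y_def using x0 by linarith+
    qed
    have "y^2 * u y < x^2 * u x"
    proof (rule DERIV_neg_imp_decreasing_open[of x y "\<lambda>r. r^2 * u r"])
      show "\<exists>z. ((\<lambda>r. r^2 * u r) has_real_derivative z) (at r) \<and> z < 0" if "x < r" "r < y" for r
        using interior_derivs(3)[of r] e(2)[of "r - x"] Fx that x0 y by auto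
      show "continuous_on {x..y} (\<lambda>r. r^2 * u r)"
        by (intro continuous_intros continuous_on_subset[OF u_continuous]) (use x0 y in auto)
    qed (use y in simp)
    moreover have "0 \<le> y^2 * u y" using near[of y] y by simp
    ultimately show False using ux by simp
  qed
qed

end

theorem proposition3:
  fixes R t :: real and h :: "real \<Rightarrow> real"
  assumes "R > 0" and "t < 1"
    and "h \<in> W_h R t"
    and "local_minimizer R t h"
    and "\<forall>r\<in>{0<..R}. 0 \<le> h r \<and> h r \<le> h_plus t"
  shows "strict_mono_on {0<..<R} h \<and>
         (\<forall>r\<in>{0<..R}. \<exists>D>0. (h has_real_derivative D) (at r within {0<..R}))"
proof -
  have bnd: "\<bar>h r\<bar> \<le> h_plus t" if "r \<in> {0<..<R}" for r
    using assms(5) that by auto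
  obtain v where hv: "has_weak_deriv {0<..<R} h v"
    and v2: "(\<lambda>r. r^2 * (v r)^2) absolutely_integrable_on {0<..<R}"
    using assms(3) unfolding W_h_def by blast
  obtain u where u: "\<And>x. x \<in> {0<..R} \<Longrightarrow> (h has_real_derivative u x) (at x within {0<..R})"
    "\<And>x. x \<in> {0<..R} \<Longrightarrow> ((\<lambda>r. r^2 * u r) has_real_derivative
        6 * h x + x^2 * (t * h x - 3 * (h x)^2 + 2 * (h x)^3)) (at x within {0<..R})"
    using minimizer_regular[OF assms(1,4) bnd hv v2] by blast
  have hp: "0 < h_plus t" using assms(2) by (simp add: h_plus_def add_pos_nonneg)
  have root: "t * h_plus t - 3 * (h_plus t)^2 + 2 * (h_plus t)^3 = 0"
  proof -
    have "4 * h_plus t - 3 = sqrt (9 - 8 * t)" by (simp add: h_plus_def field_simps)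
    then have "(4 * h_plus t - 3)^2 = 9 - 8 * t" using assms(2) by simp
    then have "t - 3 * h_plus t + 2 * (h_plus t)^2 = 0" by (simp add: power2_eq_square algebra_simps)
    then have "h_plus t * (t - 3 * h_plus t + 2 * (h_plus t)^2) = 0" by simp
    then show ?thesis by (simp add: power2_eq_square power3_eq_cube algebra_simps)
  qed
  interpret radial_solution R t "h_plus t" h u
  proof
    show "h R = h_plus t" using assms(3) by (simp add: W_h_def)
    show "0 \<le> integral {0<..<R} (\<lambda>r. 1/2 * (r * w r)^2 + 3 * (\<psi> r)^2
           + r^2 * (t/2 - 3 * h r + 3 * (h r)^2) * (\<psi> r)^2)" if "variation R \<psi> w" for \<psi> w
      by (rule minimizer_variations(3)[OF assms(1,4) bnd hv v2 that])
  qed (use assms(1,5) hp root u in auto)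
  have "h x < h y" if "0 < x" "x < y" "y < R" for x y
  proof (rule DERIV_pos_imp_increasing[of x y h])
    show "\<exists>z. (h has_real_derivative z) (at r) \<and> 0 < z" if "x \<le> r" "r \<le> y" for r
      using interior_derivs(1)[of r] u_pos[of r] that \<open>0 < x\<close> \<open>y < R\<close> by auto
  qed (use that in simp)
  then have "strict_mono_on {0<..<R} h" by (intro strict_mono_onI) auto
  then show ?thesis using u(1) u_pos by blast
qed

end
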